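(* Let $\Bbbk$ be an algebraically closed field of characteristic zero, $q\in\Bbbk$ nonzero and not a root of unity, $R=\Bbbk\langle x,y:yx=qxy+1\rangle$, $\mu\in\Bbbk^*$, and $\sigma$ the automorphism of $R$ with $\sigma(x)=\mu^{-1}x$, $\sigma(y)=\mu y$. Let $w=\sum_{i,j}c_{(i,j)}x^iy^j\in R$, $S=\{j-i\in\mathbb Z:c_{(i,j)}\ne0\}$, and let $\delta=\mathrm{ad}_w$ be the inner $\sigma$-derivation $\delta(a)=wa-\sigma(a)w$. Then the isotropy group $\mathrm{Aut}^\sigma_\delta(R)$ is isomorphic to: (a) $\Bbbk^*$, if $w=\sum_i c_{(i,i)}x^iy^i$ (the case $\gcd S=0$); (b) $\mathbb Z_d$, if $d=\gcd S$ and $d\in\mathbb N\setminus\{0,1\}$; (c) the trivial group $\{\mathrm{id}\}$, if $\gcd S=1$.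
   Context: All automorphisms are $\Bbbk$-algebra automorphisms. A $\sigma$-derivation of $R$ is a $\Bbbk$-linear map $\delta:R\to R$ with $\delta(ab)=\delta(a)b+\sigma(a)\delta(b)$ for all $a,b\in R$. Since $q$ is not a root of unity, every automorphism of $R$ has the form $\rho(x)=\beta^{-1}x$, $\rho(y)=\beta y$, $\beta\in\Bbbk^*$ (known fact); all of them commute with $\sigma$. The isotropy group of a $\sigma$-derivation $\delta$ is $\mathrm{Aut}_\delta^\sigma(R)=\{\rho\in\mathrm{Aut}(R):\rho\delta=\delta\rho\}$. The monomials $x^iy^j$ ($i,j\ge0$) form a basis of $R$. Convention: the gcd of $\{0\}$ and of the empty set is $0$. $\mathbb Z_d$ is the cyclic group of order $d$. *)

theory Defs
  imports "HOL-Algebra.Algebra" "HOL-Algebra.Algebraic_Closure_Type" "HOL-Library.Poly_Mapping"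
begin

datatype letter = LX | LY

datatype fword = FWord (letters: "letter list")

instantiation fword :: monoid_add
begin

definition zero_fword :: fword
  where "zero_fword = FWord []"

definition plus_fword :: "fword \<Rightarrow> fword \<Rightarrow> fword"
  where "plus_fword u v = FWord (letters u @ letters v)"

instance
  by standard (simp_all add: zero_fword_def plus_fword_def)

end

text \<open>
  Since addition of words is concatenation, the convolution product of finitely supported
  functions makes \<open>fword \<Rightarrow>\<^sub>0 'k\<close> the monoid algebra of the free monoid on two
  letters, that is, the free associative algebra on two generators.
\<close>

type_synonym 'k free_alg = "fword \<Rightarrow>\<^sub>0 'k"

definition free_gen :: "letter \<Rightarrow> 'k::field free_alg"
  where "free_gen l = Poly_Mapping.single (FWord [l]) 1"

definition free_const :: "'k::field \<Rightarrow> 'k free_alg"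
  where "free_const c = Poly_Mapping.single 0 c"

abbreviation free_ring :: "'k::field free_alg ring"
  where "free_ring \<equiv> ring_of_type_algebra"

definition qweyl_ideal :: "'k::field \<Rightarrow> 'k free_alg set"
  where "qweyl_ideal q =
    Idl\<^bsub>free_ring\<^esub> {free_gen LY * free_gen LX - (free_const q * free_gen LX * free_gen LY + 1)}"

definition qweyl :: "'k::field \<Rightarrow> 'k free_alg set ring"
  where "qweyl q = free_ring Quot qweyl_ideal q"

definition qweyl_class :: "'k::field \<Rightarrow> 'k free_alg \<Rightarrow> 'k free_alg set"
  where "qweyl_class q a = qweyl_ideal q +>\<^bsub>free_ring\<^esub> a"

definition qweyl_x :: "'k::field \<Rightarrow> 'k free_alg set"
  where "qweyl_x q = qweyl_class q (free_gen LX)"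

definition qweyl_y :: "'k::field \<Rightarrow> 'k free_alg set"
  where "qweyl_y q = qweyl_class q (free_gen LY)"

definition qweyl_scale :: "'k::field \<Rightarrow> 'k \<Rightarrow> 'k free_alg set \<Rightarrow> 'k free_alg set"
  where "qweyl_scale q c r = qweyl_class q (free_const c) \<otimes>\<^bsub>qweyl q\<^esub> r"

definition qweyl_monom :: "'k::field \<Rightarrow> nat \<Rightarrow> nat \<Rightarrow> 'k free_alg set"
  where "qweyl_monom q i j =
    (qweyl_x q [^]\<^bsub>qweyl q\<^esub> i) \<otimes>\<^bsub>qweyl q\<^esub> (qweyl_y q [^]\<^bsub>qweyl q\<^esub> j)"

definition qweyl_linear :: "'k::field \<Rightarrow> ('k free_alg set \<Rightarrow> 'k free_alg set) \<Rightarrow> bool"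
  where "qweyl_linear q f \<longleftrightarrow>
    (\<forall>a\<in>carrier (qweyl q). \<forall>b\<in>carrier (qweyl q).
       f (a \<oplus>\<^bsub>qweyl q\<^esub> b) = f a \<oplus>\<^bsub>qweyl q\<^esub> f b) \<and>
    (\<forall>c. \<forall>a\<in>carrier (qweyl q). f (qweyl_scale q c a) = qweyl_scale q c (f a))"

text \<open>
  As in \<^const>\<open>AutoGroup\<close>, maps are extensional on the carrier, so that two
  of them are equal iff they agree on the carrier.
\<close>

definition qweyl_auts :: "'k::field \<Rightarrow> ('k free_alg set \<Rightarrow> 'k free_alg set) set"
  where "qweyl_auts q =
    {\<rho> \<in> ring_hom (qweyl q) (qweyl q) \<inter> Bij (carrier (qweyl q)). qweyl_linear q \<rho>}"

definition qweyl_Aut :: "'k::field \<Rightarrow> ('k free_alg set \<Rightarrow> 'k free_alg set) monoid"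
  where "qweyl_Aut q = BijGroup (carrier (qweyl q)) \<lparr>carrier := qweyl_auts q\<rparr>"

definition skew_derivation ::
    "'k::field \<Rightarrow> ('k free_alg set \<Rightarrow> 'k free_alg set) \<Rightarrow>
     ('k free_alg set \<Rightarrow> 'k free_alg set) \<Rightarrow> bool"
  where "skew_derivation q \<sigma> \<delta> \<longleftrightarrow>
    \<delta> \<in> carrier (qweyl q) \<rightarrow>\<^sub>E carrier (qweyl q) \<and> qweyl_linear q \<delta> \<and>
    (\<forall>a\<in>carrier (qweyl q). \<forall>b\<in>carrier (qweyl q).
       \<delta> (a \<otimes>\<^bsub>qweyl q\<^esub> b) =
         (\<delta> a \<otimes>\<^bsub>qweyl q\<^esub> b) \<oplus>\<^bsub>qweyl q\<^esub> (\<sigma> a \<otimes>\<^bsub>qweyl q\<^esub> \<delta> b))"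

definition inner_skew_derivation ::
    "'k::field \<Rightarrow> ('k free_alg set \<Rightarrow> 'k free_alg set) \<Rightarrow> 'k free_alg set \<Rightarrow>
     'k free_alg set \<Rightarrow> 'k free_alg set"
  where "inner_skew_derivation q \<sigma> w =
    (\<lambda>a\<in>carrier (qweyl q).
       (w \<otimes>\<^bsub>qweyl q\<^esub> a) \<ominus>\<^bsub>qweyl q\<^esub> (\<sigma> a \<otimes>\<^bsub>qweyl q\<^esub> w))"

definition isotropy_group ::
    "'k::field \<Rightarrow> ('k free_alg set \<Rightarrow> 'k free_alg set) \<Rightarrow>
     ('k free_alg set \<Rightarrow> 'k free_alg set) monoid"
  where "isotropy_group q \<delta> = (qweyl_Aut q)
    \<lparr>carrier := {\<rho> \<in> carrier (qweyl_Aut q). \<forall>a\<in>carrier (qweyl q). \<rho> (\<delta> a) = \<delta> (\<rho> a)}\<rparr>"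

lemma ring_free_ring: "ring (free_ring :: 'k::field free_alg ring)"
proof -
  have "\<exists>y. x + y = 0" for x :: "'k free_alg"
    using add.right_inverse by blast
  thus ?thesis
    unfolding ring_of_type_algebra_def using add.right_inverse
    by unfold_locales (auto simp: algebra_simps Units_def)
qed

lemma free_ring_simps [simp]:
  "carrier (free_ring :: 'k::field free_alg ring) = UNIV"
  "monoid.mult (free_ring :: 'k::field free_alg ring) = (*)"
  "ring.add (free_ring :: 'k::field free_alg ring) = (+)"
  "one (free_ring :: 'k::field free_alg ring) = 1"
  "ring.zero (free_ring :: 'k::field free_alg ring) = 0"
  by (simp_all add: ring_of_type_algebra_def fun_eq_iff)

lemma ideal_qweyl_ideal: "ideal (qweyl_ideal q) (free_ring :: 'k::field free_alg ring)"
  unfolding qweyl_ideal_def by (rule ring.genideal_ideal[OF ring_free_ring]) simp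

lemma ring_qweyl: "ring (qweyl q)"
  unfolding qweyl_def by (rule ideal.quotient_is_ring[OF ideal_qweyl_ideal])

lemma qweyl_class_hom: "qweyl_class q \<in> ring_hom free_ring (qweyl q)"
  using ideal.rcos_ring_hom[OF ideal_qweyl_ideal[of q]]
  by (simp add: qweyl_def qweyl_class_def[abs_def])

lemma qweyl_class_closed [simp]: "qweyl_class q a \<in> carrier (qweyl q)"
  using ring_hom_closed[OF qweyl_class_hom] by simp

lemma qweyl_class_mult:
  "qweyl_class q (a * b) = qweyl_class q a \<otimes>\<^bsub>qweyl q\<^esub> qweyl_class q b"
  using ring_hom_mult[OF qweyl_class_hom, of a b q] by simp

lemma qweyl_class_add:
  "qweyl_class q (a + b) = qweyl_class q a \<oplus>\<^bsub>qweyl q\<^esub> qweyl_class q b"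
  using ring_hom_add[OF qweyl_class_hom, of a b q] by simp

lemma qweyl_class_one: "qweyl_class q 1 = \<one>\<^bsub>qweyl q\<^esub>"
  using ring_hom_one[OF qweyl_class_hom[of q]] by simp

lemma qweyl_relation:
  "qweyl_y q \<otimes>\<^bsub>qweyl q\<^esub> qweyl_x q =
     qweyl_scale q q (qweyl_x q \<otimes>\<^bsub>qweyl q\<^esub> qweyl_y q) \<oplus>\<^bsub>qweyl q\<^esub> \<one>\<^bsub>qweyl q\<^esub>"
proof -
  interpret I: ideal "qweyl_ideal q" free_ring by (rule ideal_qweyl_ideal)
  let ?a = "free_gen LY * free_gen LX" and ?b = "free_const q * free_gen LX * free_gen LY + 1"
  have "?a - ?b \<in> qweyl_ideal q"
    unfolding qweyl_ideal_def by (rule ring.genideal_self'[OF ring_free_ring]) simp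
  hence "qweyl_class q (?a - ?b) = qweyl_ideal q"
    unfolding qweyl_class_def by (rule I.a_rcos_const)
  hence z: "qweyl_class q (?a - ?b) = \<zero>\<^bsub>qweyl q\<^esub>"
    by (simp add: qweyl_def FactRing_def)
  have "qweyl_class q ?a = qweyl_class q ((?a - ?b) + ?b)" by simp
  also have "\<dots> = qweyl_class q (?a - ?b) \<oplus>\<^bsub>qweyl q\<^esub> qweyl_class q ?b"
    by (rule qweyl_class_add)
  also have "\<dots> = qweyl_class q ?b"
    unfolding z by (rule abelian_monoid.l_zero[OF abelian_group.axioms(1)[OF
          ring.is_abelian_group[OF ring_qweyl]]]) simp
  finally have "qweyl_class q ?a = qweyl_class q ?b" .
  thus ?thesis
    by (simp add: qweyl_x_def qweyl_y_def qweyl_scale_def mult.assoc qweyl_class_mult qweyl_class_add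
        qweyl_class_one)
qed

lemma free_const_central: "free_const c * a = a * free_const (c :: 'k::field)"
proof (induction a rule: update_induct)
  case const
  show ?case by simp
next
  case (update p k v)
  have "Poly_Mapping.update k v p = p + Poly_Mapping.single k v"
    using update.hyps
    by (intro poly_mapping_eqI)
      (auto simp: lookup_update lookup_add lookup_single when_def in_keys_iff)
  moreover have "free_const c * Poly_Mapping.single k v = Poly_Mapping.single k v * free_const c"
    by (simp add: free_const_def mult_single mult.commute)
  ultimately show ?case
    using update.IH by (simp add: distrib_left distrib_right)
qed

lemma qweyl_class_surj:
  assumes "r \<in> carrier (qweyl q)" obtains a where "r = qweyl_class q a"
  using assms by (auto simp: qweyl_def FactRing_def A_RCOSETS_def' qweyl_class_def)

lemma qweyl_const_central:
  assumes "r \<in> carrier (qweyl q)"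
  shows "r \<otimes>\<^bsub>qweyl q\<^esub> qweyl_class q (free_const c) = qweyl_scale q c r"
proof -
  obtain a where "r = qweyl_class q a" using qweyl_class_surj[OF assms] .
  thus ?thesis
    by (simp add: qweyl_scale_def free_const_central flip: qweyl_class_mult)
qed

lemma inner_skew_derivation_is_skew_derivation:
  assumes "\<sigma> \<in> carrier (qweyl_Aut q)" and w: "w \<in> carrier (qweyl q)"
  shows "skew_derivation q \<sigma> (inner_skew_derivation q \<sigma> w)"
proof -
  interpret R: ring "qweyl q" by (rule ring_qweyl)
  have h: "\<sigma> \<in> ring_hom (qweyl q) (qweyl q)" and lin: "qweyl_linear q \<sigma>"
    using assms(1) by (auto simp: qweyl_Aut_def qweyl_auts_def)
  have [simp]: "\<sigma> a \<in> carrier (qweyl q)" if "a \<in> carrier (qweyl q)" for a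
    using ring_hom_closed[OF h that] .
  have sc: "\<sigma> (qweyl_scale q c a) = qweyl_scale q c (\<sigma> a)" if "a \<in> carrier (qweyl q)" for a c
    using lin that by (simp add: qweyl_linear_def)
  have [simp]: "qweyl_scale q c a \<in> carrier (qweyl q)" if "a \<in> carrier (qweyl q)" for a c
    using that by (simp add: qweyl_scale_def)
  have scl: "qweyl_scale q c a \<otimes>\<^bsub>qweyl q\<^esub> b = qweyl_scale q c (a \<otimes>\<^bsub>qweyl q\<^esub> b)"
    if "a \<in> carrier (qweyl q)" "b \<in> carrier (qweyl q)" for a b c
    using that by (simp add: qweyl_scale_def R.m_assoc)
  have scr: "a \<otimes>\<^bsub>qweyl q\<^esub> qweyl_scale q c b = qweyl_scale q c (a \<otimes>\<^bsub>qweyl q\<^esub> b)"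
    if ab: "a \<in> carrier (qweyl q)" "b \<in> carrier (qweyl q)" for a b c
  proof -
    have "a \<otimes>\<^bsub>qweyl q\<^esub> qweyl_scale q c b =
        (a \<otimes>\<^bsub>qweyl q\<^esub> qweyl_class q (free_const c)) \<otimes>\<^bsub>qweyl q\<^esub> b"
      using ab by (simp add: qweyl_scale_def R.m_assoc)
    thus ?thesis using ab by (simp add: qweyl_const_central scl)
  qed
  have scm: "qweyl_scale q c (a \<ominus>\<^bsub>qweyl q\<^esub> b) = qweyl_scale q c a \<ominus>\<^bsub>qweyl q\<^esub> qweyl_scale q c b"
    if "a \<in> carrier (qweyl q)" "b \<in> carrier (qweyl q)" for a b c
    using that by (simp add: qweyl_scale_def R.minus_eq R.r_distr R.r_minus)
  let ?\<delta> = "inner_skew_derivation q \<sigma> w"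
  have "?\<delta> \<in> carrier (qweyl q) \<rightarrow>\<^sub>E carrier (qweyl q)"
    using w by (auto simp: inner_skew_derivation_def)
  moreover have "qweyl_linear q ?\<delta>"
    unfolding qweyl_linear_def inner_skew_derivation_def
    using w ring_hom_add[OF h]
    by (auto simp: sc scl scr scm[unfolded R.minus_eq] R.minus_eq R.l_distr R.r_distr R.minus_add R.a_ac)
  moreover have "?\<delta> (a \<otimes>\<^bsub>qweyl q\<^esub> b) =
         (?\<delta> a \<otimes>\<^bsub>qweyl q\<^esub> b) \<oplus>\<^bsub>qweyl q\<^esub> (\<sigma> a \<otimes>\<^bsub>qweyl q\<^esub> ?\<delta> b)"
    if ab: "a \<in> carrier (qweyl q)" "b \<in> carrier (qweyl q)" for a b
    using w ab ring_hom_mult[OF h ab]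
    by (simp add: inner_skew_derivation_def R.minus_eq R.l_distr R.r_distr R.l_minus R.r_minus
        R.m_assoc R.a_assoc R.r_neg1)
  ultimately show ?thesis by (simp add: skew_derivation_def)
qed

lemma isotropy_group_subgroup:
  assumes \<delta>: "\<delta> \<in> carrier (qweyl q) \<rightarrow> carrier (qweyl q)"
  shows "subgroup (carrier (isotropy_group q \<delta>)) (BijGroup (carrier (qweyl q)))"
proof -
  let ?C = "carrier (qweyl q)"
  let ?H = "{\<rho> \<in> qweyl_auts q. \<forall>a\<in>?C. \<rho> (\<delta> a) = \<delta> (\<rho> a)}"
  interpret R: ring "qweyl q" by (rule ring_qweyl)
  interpret B: group "BijGroup ?C" by (rule group_BijGroup)
  have sc [simp]: "qweyl_scale q c a \<in> ?C" if "a \<in> ?C" for a c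
    using that by (simp add: qweyl_scale_def)
  have H: "\<rho> \<in> ?H \<longleftrightarrow> \<rho> \<in> Bij ?C \<and> \<rho> \<in> ring_hom (qweyl q) (qweyl q) \<and>
      (\<forall>c. \<forall>a\<in>?C. \<rho> (qweyl_scale q c a) = qweyl_scale q c (\<rho> a)) \<and>
      (\<forall>a\<in>?C. \<rho> (\<delta> a) = \<delta> (\<rho> a))" for \<rho>
    by (auto simp: qweyl_auts_def qweyl_linear_def ring_hom_def)
  have "subgroup ?H (BijGroup ?C)"
  proof (rule B.subgroupI)
    show "?H \<subseteq> carrier (BijGroup ?C)"
      by (auto simp: qweyl_auts_def BijGroup_def)
    have "(\<lambda>a\<in>?C. a) \<in> ?H"
      unfolding H using \<delta> by (auto simp: id_Bij ring_hom_def Pi_def)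
    thus "?H \<noteq> {}" by blast
  next
    fix f assume f: "f \<in> ?H"
    hence fB: "f \<in> Bij ?C" unfolding H by blast
    let ?g = "\<lambda>a\<in>?C. inv_into ?C f a"
    have bij: "bij_betw f ?C ?C" using fB by (simp add: Bij_def)
    have gC: "?g a \<in> ?C" if "a \<in> ?C" for a
      using that bij by (simp add: bij_betw_def inv_into_into)
    have fg: "f (?g a) = a" if "a \<in> ?C" for a
      using that bij by (simp add: bij_betw_def f_inv_into_f)
    have fC: "f a \<in> ?C" if "a \<in> ?C" for a
      using that bij by (auto simp: bij_betw_def)
    have gI: "?g b = a" if "f a = b" "a \<in> ?C" for a b
      using that fC bij by (auto simp: bij_betw_def)
    have fh: "f \<in> ring_hom (qweyl q) (qweyl q)" using f unfolding H by blast
    have "?g \<in> ring_hom (qweyl q) (qweyl q)"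
    proof (rule ring_hom_memI)
      fix a b assume ab: "a \<in> ?C" "b \<in> ?C"
      show "?g a \<in> ?C" using gC ab by blast
      show "?g (a \<otimes>\<^bsub>qweyl q\<^esub> b) = ?g a \<otimes>\<^bsub>qweyl q\<^esub> ?g b"
        using ab by (intro gI) (simp_all only: ring_hom_mult[OF fh] gC fg R.m_closed)
      show "?g (a \<oplus>\<^bsub>qweyl q\<^esub> b) = ?g a \<oplus>\<^bsub>qweyl q\<^esub> ?g b"
        using ab by (intro gI) (simp_all only: ring_hom_add[OF fh] gC fg R.a_closed)
    next
      show "?g \<one>\<^bsub>qweyl q\<^esub> = \<one>\<^bsub>qweyl q\<^esub>"
        by (intro gI ring_hom_one[OF fh] R.one_closed)
    qed
    moreover have "?g (qweyl_scale q c a) = qweyl_scale q c (?g a)" if "a \<in> ?C" for a c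
      using f that by (intro gI) (simp_all only: H gC fg sc)
    moreover have "?g (\<delta> a) = \<delta> (?g a)" if a: "a \<in> ?C" for a
    proof (rule gI)
      have "f (\<delta> (?g a)) = \<delta> (f (?g a))" using f gC[OF a] by (simp only: H)
      thus "f (\<delta> (?g a)) = \<delta> a" by (simp only: fg[OF a])
      show "\<delta> (?g a) \<in> ?C" using \<delta> gC[OF a] by blast
    qed
    moreover have "?g \<in> Bij ?C" using restrict_inv_into_Bij[OF fB] .
    ultimately have "?g \<in> ?H" unfolding H by blast
    thus "inv\<^bsub>BijGroup ?C\<^esub> f \<in> ?H" using inv_BijGroup[OF fB] by simp
  next
    fix f g assume fg: "f \<in> ?H" "g \<in> ?H"
    hence B: "f \<in> Bij ?C" "g \<in> Bij ?C" unfolding H by blast+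
    have gC: "g a \<in> ?C" if "a \<in> ?C" for a
      using fg(2) that unfolding H by (blast intro: ring_hom_closed)
    have "compose ?C f g \<in> ?H"
      using fg \<delta> gC B compose_Bij[OF B]
      unfolding H by (auto simp: compose_def ring_hom_def Pi_def)
    thus "f \<otimes>\<^bsub>BijGroup ?C\<^esub> g \<in> ?H" using B by (simp add: BijGroup_def)
  qed
  thus ?thesis by (simp add: isotropy_group_def qweyl_Aut_def)
qed

end

theory Submission
  imports Defs
begin

text \<open>
  \<open>R\<close> acts faithfully on \<open>k[t]\<close>, \<open>x\<close> by multiplication with \<open>t\<close> and \<open>y\<close> by the \<open>q\<close>-derivative;
  \<open>z = yx - xy\<close> then acts by \<open>t\<^sup>n \<mapsto> q\<^sup>n t\<^sup>n\<close>, and since \<open>q\<close> is not a root of unity, commutation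
  with \<open>z\<close> detects the \<open>\<int>\<close>-grading in which \<open>x\<^sup>i y\<^sup>j\<close> has degree \<open>i - j\<close>. An automorphism \<open>\<rho>\<close>
  preserves the commutator ideal \<open>zR\<close>, and all units of \<open>R\<close> are scalars, so \<open>\<rho> z\<close> is a scalar
  multiple of \<open>z\<close>; hence \<open>\<rho> x\<close> and \<open>\<rho> y\<close> are homogeneous of degrees \<open>1\<close> and \<open>- 1\<close>, and comparing
  degrees in \<open>(q - 1) xy + 1 = z\<close> gives \<open>\<rho> x = \<beta>\<inverse> x\<close>, \<open>\<rho> y = \<beta> y\<close>. Such a \<open>\<rho>\<close> commutes with \<open>ad\<^sub>w\<close>
  iff \<open>\<rho> w = w\<close>, as one sees by evaluating at \<open>z\<close>, i.e. iff \<open>\<beta>\<^sup>s = 1\<close> for all \<open>s \<in> S\<close>, which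
  means \<open>\<beta>\<close> to the power \<open>gcd S\<close> is \<open>1\<close>.
\<close>

section \<open>The action on polynomials\<close>

lemma free_alg_single_induct [case_names zero add single]:
  fixes a :: "'k::field free_alg"
  assumes "P 0" "\<And>a b. P a \<Longrightarrow> P b \<Longrightarrow> P (a + b)" "\<And>w c. P (Poly_Mapping.single w c)"
  shows "P a"
proof (induction a rule: update_induct)
  case const
  show ?case by (rule assms(1))
next
  case (update p k v)
  have "Poly_Mapping.update k v p = p + Poly_Mapping.single k v"
    using update.hyps
    by (intro poly_mapping_eqI)
      (auto simp: lookup_update lookup_add lookup_single when_def in_keys_iff)
  thus ?case using update.IH assms(2,3) by simp
qed

lemma single_fword_Cons:
  "Poly_Mapping.single (FWord (l # ls)) (c::'k::field) = free_gen l * Poly_Mapping.single (FWord ls) c"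
  by (simp add: free_gen_def mult_single plus_fword_def)

lemma free_const_simps:
  "free_const 0 = (0 :: 'k::field free_alg)" "free_const 1 = (1 :: 'k free_alg)"
  "free_const (a + b) = (free_const a + free_const b :: 'k free_alg)"
  "free_const (a * b) = (free_const a * free_const b :: 'k free_alg)"
  "free_const (- a) = (- free_const a :: 'k free_alg)"
  by (simp_all add: free_const_def single_add mult_single single_uminus flip: single_one)

text \<open>Words grow from the empty word by prepending letters. A property that holds at 1 and is
  stable under scalars, sums and left multiplication by a generator therefore holds
  everywhere.\<close>

lemma free_alg_induct [case_names one scale add gen]:
  fixes a :: "'k::field free_alg"
  assumes one: "P 1" and scale: "\<And>c a. P a \<Longrightarrow> P (free_const c * a)"
    and add: "\<And>a b. P a \<Longrightarrow> P b \<Longrightarrow> P (a + b)" and gen: "\<And>l a. P a \<Longrightarrow> P (free_gen l * a)"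
  shows "P a"
proof (induction a rule: free_alg_single_induct)
  case zero
  show ?case using scale[OF one, of 0] by (simp add: free_const_simps)
next
  case (add a b)
  thus ?case by (rule assms(3))
next
  case (single w c)
  have "P (Poly_Mapping.single (FWord ls) c)" for ls
  proof (induction ls)
    case Nil
    show ?case using scale[OF one, of c] by (simp add: free_const_def zero_fword_def)
  next
    case (Cons l ls)
    thus ?case by (simp add: single_fword_Cons gen)
  qed
  thus ?case by (cases w) simp
qed

text \<open>The q-number 1 + q + ... + q^(n-1), in the closed form valid for \<open>q\<close> other
  than 1.\<close>

definition qint :: "'k::field \<Rightarrow> nat \<Rightarrow> 'k"
  where "qint q n = (q ^ n - 1) / (q - 1)"

text \<open>The Jackson derivative (p(qt) - p(t)) / ((q - 1) t). The numerator has no constant term,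
  so \<open>poly_shift 1\<close> is exact division by t.\<close>

definition qderiv :: "'k::field \<Rightarrow> 'k poly \<Rightarrow> 'k poly"
  where "qderiv q p = poly_shift 1 (smult (inverse (q - 1)) (pcompose p [:0, q:] - p))"

fun letter_act :: "'k::field \<Rightarrow> letter \<Rightarrow> 'k poly \<Rightarrow> 'k poly" where
  "letter_act q LX p = pCons 0 p"
| "letter_act q LY p = qderiv q p"

text \<open>\<open>foldr\<close> lets the rightmost letter act first, as a left module
  requires.\<close>

definition word_act :: "'k::field \<Rightarrow> fword \<Rightarrow> 'k poly \<Rightarrow> 'k poly"
  where "word_act q w = foldr (letter_act q) (letters w)"

definition free_act :: "'k::field \<Rightarrow> 'k free_alg \<Rightarrow> 'k poly \<Rightarrow> 'k poly"
  where "free_act q a p = (\<Sum>w\<in>Poly_Mapping.keys a. smult (Poly_Mapping.lookup a w) (word_act q w p))"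

lemma coeff_qderiv: "coeff (qderiv q p) n = qint q (Suc n) * coeff p (Suc n)"
  by (simp add: qderiv_def coeff_poly_shift coeff_pcompose_linear qint_def divide_inverse algebra_simps)

lemma letter_act_add: "letter_act q l (p + r) = letter_act q l p + letter_act q l r"
  by (cases l) (auto intro!: poly_eqI simp: coeff_qderiv algebra_simps)

lemma letter_act_smult: "letter_act q l (smult c p) = smult c (letter_act q l p)"
  by (cases l) (auto intro!: poly_eqI simp: coeff_qderiv algebra_simps)

lemma letter_act_0 [simp]: "letter_act q l 0 = 0"
  using letter_act_smult[of q l 0 0] by simp

lemma word_act_0 [simp]: "word_act q 0 p = p"
  by (simp add: word_act_def zero_fword_def)

lemma word_act_Cons: "word_act q (FWord (l # ls)) p = letter_act q l (word_act q (FWord ls) p)"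
  by (simp add: word_act_def)

lemma free_act_superset:
  assumes "finite A" "Poly_Mapping.keys a \<subseteq> A"
  shows "free_act q a p = (\<Sum>w\<in>A. smult (Poly_Mapping.lookup a w) (word_act q w p))"
  unfolding free_act_def using assms by (intro sum.mono_neutral_left) (auto simp: in_keys_iff)

lemma free_act_0 [simp]: "free_act q 0 p = 0"
  by (simp add: free_act_def)

lemma free_act_add: "free_act q (a + b) p = free_act q a p + free_act q b p"
proof -
  have "Poly_Mapping.keys (a + b) \<subseteq> Poly_Mapping.keys a \<union> Poly_Mapping.keys b" by (rule keys_add)
  thus ?thesis
    by (simp add: free_act_superset[of "Poly_Mapping.keys a \<union> Poly_Mapping.keys b"] lookup_add smult_add_left sum.distrib)
qed

lemma free_act_single: "free_act q (Poly_Mapping.single w c) p = smult c (word_act q w p)"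
  by (simp add: free_act_superset[of "{w}"])

lemma free_act_1 [simp]: "free_act q 1 p = p"
  by (simp add: free_act_single flip: single_one)

lemma free_act_const_mult: "free_act q (free_const c * a) p = smult c (free_act q a p)"
  by (induction a rule: free_alg_single_induct)
    (simp_all add: distrib_left free_act_add free_act_single free_const_def mult_single smult_add_right)

lemma free_act_gen_mult: "free_act q (free_gen l * a) p = letter_act q l (free_act q a p)"
proof (induction a rule: free_alg_single_induct)
  case (single w c)
  show ?case
    by (cases w) (simp add: free_act_single word_act_Cons letter_act_smult flip: single_fword_Cons)
qed (simp_all add: distrib_left free_act_add letter_act_add)

lemma free_act_mult: "free_act q (a * b) p = free_act q a (free_act q b p)"
  by (induction a rule: free_alg_induct)
    (simp_all add: mult.assoc distrib_right free_act_add free_act_const_mult free_act_gen_mult)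

lemma free_act_gen [simp]: "free_act q (free_gen l) p = letter_act q l p"
  using free_act_gen_mult[of q l 1 p] by simp

lemma free_act_const [simp]: "free_act q (free_const c) p = smult c p"
  using free_act_const_mult[of q c 1 p] by simp

lemma free_act_add_right: "free_act q a (p + r) = free_act q a p + free_act q a r"
  by (induction a rule: free_alg_induct)
    (simp_all add: free_act_add free_act_const_mult free_act_gen_mult letter_act_add smult_add_right)

lemma free_act_smult: "free_act q a (smult c p) = smult c (free_act q a p)"
  by (induction a rule: free_alg_induct)
    (simp_all add: free_act_add free_act_const_mult free_act_gen_mult letter_act_smult smult_add_right mult.commute)

lemma free_act_0_right [simp]: "free_act q a 0 = 0"
  using free_act_smult[of q a 0 0] by simp

lemma free_act_minus: "free_act q (a - b) p = free_act q a p - free_act q b p"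
  using free_act_add[of q "a - b" b p] by (simp add: eq_diff_eq)

lemma free_act_sum: "free_act q (\<Sum>i\<in>A. f i) p = (\<Sum>i\<in>A. free_act q (f i) p)"
  by (induction A rule: infinite_finite_induct) (simp_all add: free_act_add)

lemma free_act_sum_right: "free_act q a (\<Sum>i\<in>A. f i) = (\<Sum>i\<in>A. free_act q a (f i))"
  by (induction A rule: infinite_finite_induct) (simp_all add: free_act_add_right)

lemma letter_act_LX_monom: "letter_act q LX (monom c n) = monom c (Suc n)"
  by (simp add: monom_Suc)

lemma letter_act_LY_monom: "letter_act q LY (monom c n) = monom (qint q n * c) (n - 1)"
  by (cases n) (auto intro!: poly_eqI simp: coeff_qderiv qint_def)

text \<open>By linearity, since the powers of t span k[t]. Operator identities thus reduce to
  computations on t^n.\<close>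

lemma free_act_ext:
  assumes "\<And>n. free_act q a (monom 1 n) = free_act q b (monom 1 n)"
  shows "free_act q a = free_act q b"
proof
  fix p :: "'a poly"
  have "p = (\<Sum>n\<le>degree p. smult (coeff p n) (monom 1 n))"
    by (simp add: smult_monom poly_as_sum_of_monoms)
  moreover have "free_act q a (\<Sum>n\<le>degree p. smult (coeff p n) (monom 1 n)) =
      free_act q b (\<Sum>n\<le>degree p. smult (coeff p n) (monom 1 n))"
    by (simp add: free_act_sum_right free_act_smult assms)
  ultimately show "free_act q a p = free_act q b p" by simp
qed

section \<open>Linear independence of the ordered monomials\<close>

definition pbw_monom :: "nat \<Rightarrow> nat \<Rightarrow> 'k::field free_alg"
  where "pbw_monom i j = free_gen LX ^ i * free_gen LY ^ j"

text \<open>The falling q-factorial [n] [n-1] ... [n-j+1], the factor by which y^j takes t^n to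
  t^(n-j). The truncated \<open>n - 1\<close> at \<open>n = 0\<close> is harmless because
  \<open>qint q 0 = 0\<close>.\<close>

fun qfall :: "'k::field \<Rightarrow> nat \<Rightarrow> nat \<Rightarrow> 'k" where
  "qfall q n 0 = 1"
| "qfall q n (Suc j) = qint q n * qfall q (n - 1) j"

lemma qint_0 [simp]: "qint q 0 = 0"
  by (simp add: qint_def)

lemma qfall_eq_0: "n < j \<Longrightarrow> qfall q n j = 0"
proof (induction j arbitrary: n)
  case (Suc j)
  thus ?case by (cases n) simp_all
qed simp

lemma free_act_LX_power: "free_act q (free_gen LX ^ i) (monom c n) = monom c (n + i)"
  by (induction i) (simp_all add: free_act_gen_mult monom_Suc)

lemma free_act_LY_power: "free_act q (free_gen LY ^ j) (monom c n) = monom (qfall q n j * c) (n - j)"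
proof (induction j arbitrary: c n)
  case (Suc j)
  have "free_act q (free_gen LY ^ Suc j) (monom c n) =
      free_act q (free_gen LY ^ j) (letter_act q LY (monom c n))"
    by (simp only: power_Suc2 free_act_mult free_act_gen)
  also have "\<dots> = monom (qfall q n (Suc j) * c) (n - Suc j)"
    by (simp only: letter_act_LY_monom Suc.IH) (simp add: mult_ac)
  finally show ?case .
qed simp

text \<open>Truncation of \<open>n - j\<close> does no damage: for \<open>n < j\<close> the factor
  \<open>qfall q n j\<close> is 0.\<close>

lemma free_act_pbw_monom:
  "free_act q (pbw_monom i j) (monom c n) = monom (qfall q n j * c) (n - j + i)"
  by (simp add: pbw_monom_def free_act_mult free_act_LY_power free_act_LX_power)

definition pbw_sum :: "(nat \<times> nat \<Rightarrow> 'k::field) \<Rightarrow> 'k free_alg"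
  where "pbw_sum c = (\<Sum>p\<in>{p. c p \<noteq> 0}. free_const (c p) * pbw_monom (fst p) (snd p))"

lemma pbw_sum_superset:
  assumes "finite A" "{p. c p \<noteq> 0} \<subseteq> A"
  shows "pbw_sum c = (\<Sum>p\<in>A. free_const (c p) * pbw_monom (fst p) (snd p))"
  unfolding pbw_sum_def using assms by (intro sum.mono_neutral_left) (auto simp: free_const_simps)

lemma coeff_free_act_pbw_sum:
  assumes "finite A" "{p. c p \<noteq> 0} \<subseteq> A"
  shows "coeff (free_act q (pbw_sum c) (monom 1 n)) m =
    (\<Sum>p\<in>A. if n - snd p + fst p = m then c p * qfall q n (snd p) else 0)"
  by (simp add: pbw_sum_superset[OF assms] free_act_sum free_act_const_mult free_act_pbw_monom
      coeff_sum smult_monom if_distrib cong: if_cong)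

lemma qfall_neq_0:
  assumes "\<And>n. n > 0 \<Longrightarrow> q ^ n \<noteq> 1" "j \<le> n"
  shows "qfall q n j \<noteq> 0"
  using assms(2)
proof (induction j arbitrary: n)
  case (Suc j)
  have "q \<noteq> 1" using assms(1)[of 1] by simp
  with Suc assms(1)[of n] show ?case by (simp add: qint_def)
qed simp

text \<open>
  Evaluating at \<open>t\<^sup>n\<close> with \<open>n\<close> the least \<open>y\<close>-exponent kills every other \<open>y\<close>-exponent.
\<close>

lemma pbw_sum_independent:
  assumes q: "\<And>n. n > 0 \<Longrightarrow> q ^ n \<noteq> 1" and fin: "finite {p. c p \<noteq> 0}"
    and zero: "free_act q (pbw_sum c) = free_act q 0"
  shows "c p = 0"
proof (rule ccontr)
  assume "c p \<noteq> 0"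
  let ?J = "snd ` {p. c p \<noteq> 0}"
  define n where "n = Min ?J"
  have "snd p \<in> ?J" using \<open>c p \<noteq> 0\<close> by blast
  hence J: "finite ?J" "?J \<noteq> {}" using fin by auto
  then obtain i where i: "c (i, n) \<noteq> 0"
    using Min_in[OF J] unfolding n_def by force
  have min: "n \<le> snd r" if "c r \<noteq> 0" for r
    unfolding n_def using J that by (intro Min_le) auto
  have "coeff (free_act q (pbw_sum c) (monom 1 n)) i =
      (\<Sum>r\<in>{p. c p \<noteq> 0}. if n - snd r + fst r = i then c r * qfall q n (snd r) else 0)"
    by (rule coeff_free_act_pbw_sum[OF fin]) simp
  also have "\<dots> = (\<Sum>r\<in>{(i, n)}. if n - snd r + fst r = i then c r * qfall q n (snd r) else 0)"
  proof (rule sum.mono_neutral_right)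
    show "\<forall>r\<in>{p. c p \<noteq> 0} - {(i, n)}.
        (if n - snd r + fst r = i then c r * qfall q n (snd r) else 0) = 0"
    proof
      \<comment> \<open>If \<open>snd r = n\<close>, the degree condition forces
        \<open>fst r = i\<close> and so \<open>r = (i, n)\<close>. Any other contributing
        \<open>r\<close> has a larger y-exponent, which kills t^n.\<close>
      fix r assume r: "r \<in> {p. c p \<noteq> 0} - {(i, n)}"
      hence "n < snd r" if "n - snd r + fst r = i"
        using that min[of r] by (cases r) (auto simp: le_less)
      thus "(if n - snd r + fst r = i then c r * qfall q n (snd r) else 0) = 0"
        by (simp add: qfall_eq_0)
    qed
  qed (use fin i in auto)
  finally have "c (i, n) * qfall q n n = 0" by (simp add: zero)
  thus False using i qfall_neq_0[OF q, of n n] by simp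
qed

section \<open>The monomial basis\<close>

text \<open>On t^n the defining relation is the recursion [n+1] = q [n] + 1 of the
  q-numbers.\<close>

lemma free_act_relation:
  assumes "q \<noteq> 1"
  shows "free_act q (free_gen LY * free_gen LX) =
    free_act q (free_const q * free_gen LX * free_gen LY + 1)"
proof (rule free_act_ext)
  fix n
  have "qint q (Suc n) = q * qint q n + 1"
    using assms by (simp add: qint_def divide_simps) (simp add: algebra_simps)
  thus "free_act q (free_gen LY * free_gen LX) (monom 1 n) =
      free_act q (free_const q * free_gen LX * free_gen LY + 1) (monom 1 n)"
    by (cases n) (auto simp: free_act_mult free_act_add letter_act_LX_monom letter_act_LY_monom
        smult_monom add_monom simp del: letter_act.simps monom_eq_1)
qed

lemma ideal_free_act_kernel: "ideal {a. free_act q a = (\<lambda>p. 0)} free_ring"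
proof -
  interpret ring "free_ring :: 'a free_alg ring" by (rule ring_free_ring)
  have inv: "\<ominus>\<^bsub>free_ring\<^esub> a = - a" for a :: "'a free_alg"
    by (rule minus_equality) simp_all
  have inv': "inv\<^bsub>add_monoid free_ring\<^esub> a = - a" for a :: "'a free_alg"
    using inv[of a] by (simp add: a_inv_def)
  have sg: "subgroup {a. free_act q a = (\<lambda>p. 0)} (add_monoid free_ring)"
    by (rule add.subgroupI)
      (auto simp: fun_eq_iff free_act_add inv' inv free_act_minus[of q 0, simplified]
        intro!: exI[of _ 0])
  show ?thesis
    by (rule idealI[OF ring_axioms sg]) (auto simp: fun_eq_iff free_act_mult)
qed

lemma qweyl_class_eq_iff_mem: "qweyl_class q a = qweyl_class q b \<longleftrightarrow> a - b \<in> qweyl_ideal q"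
proof -
  interpret I: ideal "qweyl_ideal q" free_ring by (rule ideal_qweyl_ideal)
  have inv: "\<ominus>\<^bsub>free_ring\<^esub> b = - b"
    by (rule I.minus_equality) simp_all
  show ?thesis
    using I.quotient_eq_iff_same_a_r_cos[OF ideal_qweyl_ideal, of a b] by (simp add: qweyl_class_def a_minus_def inv)
qed

text \<open>The kernel of the action is a two-sided ideal containing the generator of
  \<open>qweyl_ideal q\<close>, so the action descends to the quotient.\<close>

lemma free_act_cong_class:
  assumes "q \<noteq> 1" "qweyl_class q a = qweyl_class q b"
  shows "free_act q a = free_act q b"
proof -
  have "qweyl_ideal q \<subseteq> {a. free_act q a = (\<lambda>p. 0)}"
    unfolding qweyl_ideal_def
    by (rule ring.genideal_minimal[OF ring_free_ring ideal_free_act_kernel])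
      (simp add: fun_eq_iff free_act_minus free_act_relation[OF assms(1)])
  with assms(2) have "free_act q (a - b) = (\<lambda>p. 0)"
    unfolding qweyl_class_eq_iff_mem by blast
  thus ?thesis by (simp add: fun_eq_iff free_act_minus)
qed

section \<open>Spanning by the ordered monomials, and faithfulness of the action\<close>

lemma qweyl_class_const_mult: "qweyl_class q (free_const c * a) = qweyl_scale q c (qweyl_class q a)"
  by (simp add: qweyl_class_mult qweyl_scale_def)

lemma qweyl_class_mult_cong:
  assumes "qweyl_class q a = qweyl_class q b"
  shows "qweyl_class q (c * a) = qweyl_class q (c * b)" "qweyl_class q (a * c) = qweyl_class q (b * c)"
  using assms by (simp_all add: qweyl_class_mult)

lemma qweyl_class_LY_LX:
  "qweyl_class q (free_gen LY * free_gen LX) =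
    qweyl_class q (free_const q * free_gen LX * free_gen LY + 1)"
  using qweyl_relation[of q]
  by (simp add: qweyl_x_def qweyl_y_def qweyl_class_mult qweyl_class_add qweyl_class_one
      qweyl_scale_def mult.assoc)

text \<open>Moving y past x one factor at a time gives y x^n = q^n x^n y + [n] x^(n-1). The q-number
  is written as a sum, which keeps its meaning at \<open>q = 1\<close>, unlike the quotient in
  \<open>qint\<close>.\<close>

lemma qweyl_class_LY_LX_power:
  "qweyl_class q (free_gen LY * free_gen LX ^ Suc i) =
    qweyl_class q (free_const (q ^ Suc i) * free_gen LX ^ Suc i * free_gen LY
      + free_const (\<Sum>k\<le>i. q ^ k) * free_gen LX ^ i)"
proof (induction i)
  case 0
  show ?case using qweyl_class_LY_LX[of q] by (simp add: free_const_simps)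
next
  case (Suc i)
  let ?X = "free_gen LX" and ?Y = "free_gen LY"
  have "qweyl_class q (?Y * ?X ^ Suc (Suc i)) = qweyl_class q ((?Y * ?X ^ Suc i) * ?X)"
    by (simp only: power_Suc2 mult.assoc)
  also have "\<dots> = qweyl_class q ((free_const (q ^ Suc i) * ?X ^ Suc i * ?Y
      + free_const (\<Sum>k\<le>i. q ^ k) * ?X ^ i) * ?X)"
    by (rule qweyl_class_mult_cong(2)[OF Suc.IH])
  also have "\<dots> = qweyl_class q (free_const (q ^ Suc i) * ?X ^ Suc i * (?Y * ?X)
      + free_const (\<Sum>k\<le>i. q ^ k) * ?X ^ Suc i)"
    by (simp only: distrib_right mult.assoc power_Suc2)
  also have "\<dots> = qweyl_class q (free_const (q ^ Suc i) * ?X ^ Suc i *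
      (free_const q * ?X * ?Y + 1) + free_const (\<Sum>k\<le>i. q ^ k) * ?X ^ Suc i)"
    by (simp only: qweyl_class_add qweyl_class_mult_cong(1)[OF qweyl_class_LY_LX])
  also have "free_const (q ^ Suc i) * ?X ^ Suc i * (free_const q * ?X * ?Y + 1)
      + free_const (\<Sum>k\<le>i. q ^ k) * ?X ^ Suc i =
      free_const (q ^ Suc (Suc i)) * ?X ^ Suc (Suc i) * ?Y
      + free_const (\<Sum>k\<le>Suc i. q ^ k) * ?X ^ Suc i"
  proof -
    have "free_const (q ^ Suc i) * ?X ^ Suc i * (free_const q * ?X * ?Y) =
        free_const (q ^ Suc i) * (?X ^ Suc i * free_const q) * ?X * ?Y"
      by (simp only: mult.assoc)
    also have "\<dots> = (free_const (q ^ Suc i) * free_const q) * (?X ^ Suc i * ?X) * ?Y"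
      by (simp only: free_const_central[of q "?X ^ Suc i", symmetric] mult.assoc)
    also have "\<dots> = free_const (q ^ Suc (Suc i)) * ?X ^ Suc (Suc i) * ?Y"
      by (simp only: power_Suc2 free_const_simps)
    finally show ?thesis
      by (simp only: distrib_left distrib_right mult_1_right free_const_simps sum.atMost_Suc
          add.assoc add.commute add.left_commute)
  qed
  finally show ?case .
qed

definition pbw_span :: "'k::field \<Rightarrow> 'k free_alg set"
  where "pbw_span q = {a. \<exists>c. finite {p. c p \<noteq> 0} \<and> qweyl_class q a = qweyl_class q (pbw_sum c)}"

lemma pbw_span_cong:
  "\<lbrakk>a \<in> pbw_span q; qweyl_class q a = qweyl_class q b\<rbrakk> \<Longrightarrow> b \<in> pbw_span q"
  by (auto simp: pbw_span_def)

lemma pbw_span_add: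
  assumes "a \<in> pbw_span q" "b \<in> pbw_span q"
  shows "a + b \<in> pbw_span q"
proof -
  from assms obtain c d where cd: "finite {p. c p \<noteq> 0}" "finite {p. d p \<noteq> 0}"
    "qweyl_class q a = qweyl_class q (pbw_sum c)" "qweyl_class q b = qweyl_class q (pbw_sum d)"
    by (auto simp: pbw_span_def)
  let ?A = "{p. c p \<noteq> 0} \<union> {p. d p \<noteq> 0}"
  have fin: "finite ?A" using cd by simp
  have "pbw_sum (\<lambda>p. c p + d p) = pbw_sum c + pbw_sum d"
    by (subst (1 2 3) pbw_sum_superset[OF fin])
      (auto simp: free_const_simps distrib_right sum.distrib)
  moreover have "finite {p. c p + d p \<noteq> 0}"
    by (rule finite_subset[OF _ fin]) auto
  ultimately show ?thesis
    using cd unfolding pbw_span_def by (auto simp: qweyl_class_add intro!: exI[of _ "\<lambda>p. c p + d p"])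
qed

lemma pbw_span_0: "0 \<in> pbw_span q"
  unfolding pbw_span_def by (auto intro!: exI[of _ "\<lambda>p. 0"] simp: pbw_sum_def)

lemma pbw_span_sum: "(\<And>i. i \<in> A \<Longrightarrow> f i \<in> pbw_span q) \<Longrightarrow> (\<Sum>i\<in>A. f i) \<in> pbw_span q"
  by (induction A rule: infinite_finite_induct) (auto simp: pbw_span_0 pbw_span_add)

lemma pbw_span_monom: "free_const c * pbw_monom i j \<in> pbw_span q"
proof -
  have "pbw_sum (\<lambda>p. if p = (i, j) then c else 0) = free_const c * pbw_monom i j"
    by (subst pbw_sum_superset[of "{(i, j)}"]) auto
  thus ?thesis unfolding pbw_span_def
    by (auto intro!: exI[of _ "\<lambda>p. if p = (i, j) then c else 0"])
qed

text \<open>Only y in front of a positive power of x is out of order; moving it to its place leaves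
  one further ordered term.\<close>

lemma gen_mult_pbw_monom:
  fixes q :: "'k::field"
  shows "free_gen l * pbw_monom i j \<in> pbw_span q"
proof (cases l)
  case LX
  have "free_gen LX * pbw_monom i j = free_const (1::'k) * pbw_monom (Suc i) j"
    by (simp add: pbw_monom_def mult.assoc free_const_simps)
  thus ?thesis unfolding LX by (simp only: pbw_span_monom)
next
  case LY
  show ?thesis
  proof (cases i)
    case 0
    have "free_gen LY * pbw_monom 0 j = free_const (1::'k) * pbw_monom 0 (Suc j)"
      by (simp add: pbw_monom_def free_const_simps)
    thus ?thesis unfolding LY 0 by (simp only: pbw_span_monom)
  next
    case (Suc i')
    let ?b = "free_const (q ^ i) * pbw_monom i (Suc j) + free_const (\<Sum>k\<le>i'. q ^ k) * pbw_monom i' j"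
    have "qweyl_class q (free_gen LY * pbw_monom i j) = qweyl_class q ((free_gen LY * free_gen LX ^ Suc i') * free_gen LY ^ j)"
      by (simp only: pbw_monom_def mult.assoc Suc)
    also have "\<dots> = qweyl_class q ?b"
      unfolding qweyl_class_mult_cong(2)[OF qweyl_class_LY_LX_power]
      by (simp only: distrib_right mult.assoc Suc pbw_monom_def power_Suc)
    finally have "qweyl_class q ?b = qweyl_class q (free_gen LY * pbw_monom i j)" by simp
    moreover have "?b \<in> pbw_span q" by (intro pbw_span_add pbw_span_monom)
    ultimately show ?thesis unfolding LY by (rule pbw_span_cong[rotated])
  qed
qed

lemma pbw_span_scale:
  assumes "a \<in> pbw_span q"
  shows "free_const c * a \<in> pbw_span q"
proof -
  from assms obtain d where d: "finite {p. d p \<noteq> 0}" "qweyl_class q a = qweyl_class q (pbw_sum d)"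
    by (auto simp: pbw_span_def)
  have "free_const c * pbw_sum d =
      (\<Sum>p\<in>{p. d p \<noteq> 0}. free_const (c * d p) * pbw_monom (fst p) (snd p))"
    by (simp add: pbw_sum_def sum_distrib_left free_const_simps mult.assoc)
  also have "\<dots> \<in> pbw_span q" by (intro pbw_span_sum pbw_span_monom)
  finally show ?thesis
    by (rule pbw_span_cong) (rule qweyl_class_mult_cong(1)[OF d(2)[symmetric]])
qed

lemma free_const_left_commute: "a * (free_const c * b) = free_const c * (a * b)"
  by (metis free_const_central mult.assoc)

lemma pbw_span_gen_mult:
  assumes "a \<in> pbw_span q"
  shows "free_gen l * a \<in> pbw_span q"
proof -
  from assms obtain d where d: "finite {p. d p \<noteq> 0}" "qweyl_class q a = qweyl_class q (pbw_sum d)"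
    by (auto simp: pbw_span_def)
  have "free_gen l * pbw_sum d =
      (\<Sum>p\<in>{p. d p \<noteq> 0}. free_const (d p) * (free_gen l * pbw_monom (fst p) (snd p)))"
    by (simp add: pbw_sum_def sum_distrib_left free_const_left_commute)
  also have "\<dots> \<in> pbw_span q" by (intro pbw_span_sum pbw_span_scale gen_mult_pbw_monom)
  finally show ?thesis
    by (rule pbw_span_cong) (rule qweyl_class_mult_cong(1)[OF d(2)[symmetric]])
qed

lemma pbw_span_UNIV: "a \<in> pbw_span q"
proof (induction a rule: free_alg_induct)
  case one
  show ?case using pbw_span_monom[of 1 0 0 q] by (simp add: free_const_simps pbw_monom_def)
qed (simp_all add: pbw_span_add pbw_span_scale pbw_span_gen_mult)

text \<open>Faithfulness: modulo the ideal, \<open>a - b\<close> is a combination of ordered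
  monomials, and these act as linearly independent operators. Equality in the quotient can now be
  tested on polynomials.\<close>

lemma qweyl_class_eq_iff:
  assumes q: "\<And>n. n > 0 \<Longrightarrow> q ^ n \<noteq> 1"
  shows "qweyl_class q a = qweyl_class q b \<longleftrightarrow> free_act q a = free_act q b"
proof
  have q1: "q \<noteq> 1" using q[of 1] by simp
  show "free_act q a = free_act q b" if "qweyl_class q a = qweyl_class q b"
    using free_act_cong_class[OF q1 that] .
  assume eq: "free_act q a = free_act q b"
  from pbw_span_UNIV[of "a - b" q] obtain c where c: "finite {p. c p \<noteq> 0}"
    "qweyl_class q (a - b) = qweyl_class q (pbw_sum c)"
    by (auto simp: pbw_span_def)
  have "free_act q (pbw_sum c) = free_act q (a - b)"
    using free_act_cong_class[OF q1 c(2)] by simp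
  also have "\<dots> = free_act q 0" using eq by (simp add: fun_eq_iff free_act_minus)
  finally have "c p = 0" for p using pbw_sum_independent[OF q c(1)] by blast
  hence "pbw_sum c = 0" by (simp add: pbw_sum_def)
  with c(2) show "qweyl_class q a = qweyl_class q b"
    by (simp add: qweyl_class_eq_iff_mem)
qed

section \<open>Homogeneous components and the normal element\<close>

text \<open>Written as a commutator rather than as (q - 1) xy + 1, so that its image under an
  automorphism is visibly a commutator.\<close>

definition free_z :: "'k::field free_alg"
  where "free_z = free_gen LY * free_gen LX - free_gen LX * free_gen LY"

lemma qint_Suc: "q \<noteq> 1 \<Longrightarrow> qint q (Suc n) = qint q n + q ^ n"
  by (simp add: qint_def divide_simps) (simp add: algebra_simps)

text \<open>yx and xy multiply t^m by [m+1] and [m], and these differ by q^m.\<close>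

lemma coeff_free_act_z:
  assumes "q \<noteq> 1"
  shows "coeff (free_act q free_z p) m = q ^ m * coeff p m"
  using assms
  by (cases m) (simp_all add: free_z_def free_act_minus free_act_mult coeff_qderiv qint_Suc algebra_simps)

lemma free_act_z_monom: "q \<noteq> 1 \<Longrightarrow> free_act q free_z (monom c n) = monom (q ^ n * c) n"
  by (rule poly_eqI) (simp add: coeff_free_act_z)

lemma free_act_mult_cong:
  assumes "free_act q a = free_act q a'" "free_act q b = free_act q b'"
  shows "free_act q (a * b) = free_act q (a' * b')"
  using assms by (simp add: fun_eq_iff free_act_mult)

lemma free_act_add_cong:
  assumes "free_act q a = free_act q a'" "free_act q b = free_act q b'"
  shows "free_act q (a + b) = free_act q (a' + b')"
  using assms by (simp add: fun_eq_iff free_act_add)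

section \<open>Commutators are multiples of z\<close>

definition free_z_multiples :: "'k::field \<Rightarrow> 'k free_alg set"
  where "free_z_multiples q = {a. \<exists>c. free_act q a = free_act q (free_z * c)}"

lemma free_z_multiplesI: "free_act q a = free_act q (free_z * c) \<Longrightarrow> a \<in> free_z_multiples q"
  by (auto simp: free_z_multiples_def)

lemma free_z_multiples_0: "0 \<in> free_z_multiples q"
  by (rule free_z_multiplesI[of _ _ 0]) simp

lemma free_z_multiples_add:
  assumes "a \<in> free_z_multiples q" "b \<in> free_z_multiples q"
  shows "a + b \<in> free_z_multiples q"
proof -
  from assms obtain c d where
    "free_act q a = free_act q (free_z * c)" "free_act q b = free_act q (free_z * d)"
    by (auto simp: free_z_multiples_def)
  from free_act_add_cong[OF this] show ?thesis
    by (intro free_z_multiplesI[of _ _ "c + d"]) (simp add: distrib_left)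
qed

lemma free_z_multiples_right:
  assumes "a \<in> free_z_multiples q"
  shows "a * b \<in> free_z_multiples q"
proof -
  from assms obtain c where "free_act q a = free_act q (free_z * c)"
    by (auto simp: free_z_multiples_def)
  from free_act_mult_cong[OF this refl, of b] show ?thesis
    by (intro free_z_multiplesI[of _ _ "c * b"]) (simp add: mult.assoc)
qed

lemma free_z_multiples_const:
  "a \<in> free_z_multiples q \<Longrightarrow> free_const c * a \<in> free_z_multiples q"
  using free_z_multiples_right[of a q "free_const c"] by (simp add: free_const_central)

text \<open>z is normal: x z = q^(-1) z x and y z = q z y. Hence the right multiples of z form a
  two-sided ideal.\<close>

lemma gen_mult_free_z:
  assumes "q \<noteq> 0" "q \<noteq> 1"
  shows "free_gen l * free_z \<in> free_z_multiples q"
proof (rule free_z_multiplesI, rule free_act_ext)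
  fix n
  let ?c = "case l of LX \<Rightarrow> inverse q | LY \<Rightarrow> q"
  show "free_act q (free_gen l * free_z) (monom 1 n) =
      free_act q (free_z * (free_const ?c * free_gen l)) (monom 1 n)"
    using assms
    by (cases l; cases n)
      (simp_all add: free_act_mult free_act_z_monom letter_act_LX_monom letter_act_LY_monom smult_monom
        del: letter_act.simps monom_eq_1)
qed

lemma free_z_multiples_left:
  assumes q: "q \<noteq> 0" "q \<noteq> 1" and a: "a \<in> free_z_multiples q"
  shows "b * a \<in> free_z_multiples q"
proof (induction b rule: free_alg_induct)
  case (gen l b)
  then obtain c where c: "free_act q (b * a) = free_act q (free_z * c)"
    by (auto simp: free_z_multiples_def)
  have "(free_gen l * free_z) * c \<in> free_z_multiples q"
    by (intro free_z_multiples_right gen_mult_free_z q)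
  moreover have "free_act q (free_gen l * b * a) = free_act q ((free_gen l * free_z) * c)"
    unfolding mult.assoc by (rule free_act_mult_cong[OF refl c])
  ultimately show ?case by (simp add: free_z_multiples_def)
qed (simp_all add: a distrib_right free_z_multiples_add free_z_multiples_const mult.assoc)

lemma commutator_gen_gen: "free_gen l * free_gen l' - free_gen l' * free_gen l \<in> free_z_multiples q"
proof (cases l; cases l')
  assume "l = LX" "l' = LY"
  thus ?thesis
    by (intro free_z_multiplesI[of _ _ "- 1"] arg_cong[of _ _ "free_act q"]) (simp add: free_z_def)
next
  assume "l = LY" "l' = LX"
  thus ?thesis
    by (intro free_z_multiplesI[of _ _ 1] arg_cong[of _ _ "free_act q"]) (simp add: free_z_def)
qed (simp_all add: free_z_multiples_0)

text \<open>The Leibniz rule [l, l' b] = [l, l'] b + l' [l, b] reduces to commutators of two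
  generators, and the two-sided ideal absorbs the outer factors.\<close>

lemma commutator_gen:
  assumes q: "q \<noteq> 0" "q \<noteq> 1"
  shows "free_gen l * b - b * free_gen l \<in> free_z_multiples q"
proof (induction b rule: free_alg_induct)
  case one
  show ?case by (simp add: free_z_multiples_0)
next
  case (scale c b)
  have "free_gen l * (free_const c * b) - (free_const c * b) * free_gen l =
      free_const c * (free_gen l * b - b * free_gen l)"
    by (simp add: right_diff_distrib mult.assoc free_const_left_commute[of "free_gen l"])
  thus ?case using scale by (simp add: free_z_multiples_const)
next
  case (add a b)
  have "free_gen l * (a + b) - (a + b) * free_gen l =
      (free_gen l * a - a * free_gen l) + (free_gen l * b - b * free_gen l)"
    by (simp add: algebra_simps)
  thus ?case using add by (simp only: free_z_multiples_add)
next
  case (gen l' b)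
  have "free_gen l * (free_gen l' * b) - (free_gen l' * b) * free_gen l =
      (free_gen l * free_gen l' - free_gen l' * free_gen l) * b
      + free_gen l' * (free_gen l * b - b * free_gen l)"
    by (simp add: algebra_simps)
  also have "\<dots> \<in> free_z_multiples q"
    by (intro free_z_multiples_add free_z_multiples_right free_z_multiples_left q gen commutator_gen_gen)
  finally show ?case .
qed

text \<open>The Leibniz rule in the first argument reduces to commutators with one generator. In
  other words, R modulo zR is commutative.\<close>

lemma commutator_free_z_multiples:
  assumes q: "q \<noteq> 0" "q \<noteq> 1"
  shows "a * b - b * a \<in> free_z_multiples q"
proof (induction a rule: free_alg_induct)
  case one
  show ?case by (simp add: free_z_multiples_0)
next
  case (scale c a)
  have "(free_const c * a) * b - b * (free_const c * a) = free_const c * (a * b - b * a)"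
    by (simp add: right_diff_distrib mult.assoc free_const_left_commute[of b])
  thus ?case using scale by (simp add: free_z_multiples_const)
next
  case (add a a')
  have "(a + a') * b - b * (a + a') = (a * b - b * a) + (a' * b - b * a')"
    by (simp add: algebra_simps)
  thus ?case using add by (simp only: free_z_multiples_add)
next
  case (gen l a)
  have "(free_gen l * a) * b - b * (free_gen l * a) =
      free_gen l * (a * b - b * a) + (free_gen l * b - b * free_gen l) * a"
    by (simp add: algebra_simps)
  also have "\<dots> \<in> free_z_multiples q"
    by (intro free_z_multiples_add free_z_multiples_right free_z_multiples_left q gen commutator_gen)
  finally show ?case .
qed

section \<open>Components of operators by degree\<close>

text \<open>
  The condition for \<open>n + d < 0\<close> records that an operator in the image of \<open>free_act\<close> cannot move
  \<open>t\<^sup>n\<close> out of the polynomials; \<open>K d\<close> is the coefficient of degree \<open>d\<close> of the operator,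
  as a polynomial in the diagonal operator \<open>t\<^sup>n \<mapsto> q\<^sup>n t\<^sup>n\<close>.
\<close>

definition is_kernel :: "'k::field \<Rightarrow> 'k free_alg \<Rightarrow> (int \<Rightarrow> 'k poly) \<Rightarrow> bool"
  where "is_kernel q a K \<longleftrightarrow> finite {d. K d \<noteq> 0} \<and>
    (\<forall>n d. int n + d < 0 \<longrightarrow> poly (K d) (q ^ n) = 0) \<and>
    (\<forall>n m. coeff (free_act q a (monom 1 n)) m = poly (K (int m - int n)) (q ^ n))"

lemma is_kernel_gen_LX:
  assumes "is_kernel q a K"
  shows "is_kernel q (free_gen LX * a) (\<lambda>d. K (d - 1))"
proof -
  have "finite ((\<lambda>d. d - 1) -` {d. K d \<noteq> 0})"
    using assms by (intro finite_vimageI) (auto simp: is_kernel_def inj_def)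
  hence "finite {d. K (d - 1) \<noteq> 0}" by (simp add: vimage_def)
  thus ?thesis
    using assms by (auto simp: is_kernel_def free_act_gen_mult coeff_pCons algebra_simps split: nat.split)
qed

text \<open>y multiplies t^(n+d+1) by [n+d+1], which is (q^(d+1) q^n - 1) / (q - 1) and thus a
  polynomial in q^n. This linear factor vanishes when n + d + 1 = 0, the one new case of the
  condition on negative exponents.\<close>

lemma is_kernel_gen_LY:
  assumes q: "q \<noteq> 0" "q \<noteq> 1" and K: "is_kernel q a K"
  shows "is_kernel q (free_gen LY * a)
    (\<lambda>d. smult (inverse (q - 1)) (K (d + 1) * [:- 1, q powi (d + 1):]))"
    (is "is_kernel q _ ?H")
proof -
  have "finite ((\<lambda>d. d + 1) -` {d. K d \<noteq> 0})"
    using K by (intro finite_vimageI) (auto simp: is_kernel_def inj_def)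
  hence "finite {d. ?H d \<noteq> 0}" by (rule finite_subset[rotated]) auto
  moreover have "poly (?H d) (q ^ n) = 0" if "int n + d < 0" for n d
  proof (cases "int n + d + 1 < 0")
    case True
    thus ?thesis using K by (simp add: is_kernel_def add.assoc)
  next
    case False
    with that have "d + 1 = - int n" by simp
    thus ?thesis using q by (simp add: power_int_minus)
  qed
  moreover have "coeff (free_act q (free_gen LY * a) (monom 1 n)) m = poly (?H (int m - int n)) (q ^ n)"
    for n m
  proof -
    have "q ^ n * q powi (1 + int m - int n) = q powi (int n + (1 + int m - int n))"
      by (subst power_int_add) (use q in simp_all)
    also have "int n + (1 + int m - int n) = int (Suc m)" by simp
    finally have e: "q ^ n * q powi (1 + int m - int n) = q * q ^ m"
      by (simp only: power_int_of_nat power_Suc)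
    show ?thesis
      using K e by (simp add: is_kernel_def free_act_gen_mult coeff_qderiv qint_def divide_inverse algebra_simps)
  qed
  ultimately show ?thesis unfolding is_kernel_def by blast
qed

lemma is_kernel_exists:
  fixes q :: "'k::field"
  assumes q: "q \<noteq> 0" "q \<noteq> 1"
  shows "\<exists>K. is_kernel q a K"
proof (induction a rule: free_alg_induct)
  case one
  have "is_kernel q (1 :: 'k free_alg) (\<lambda>d. if d = 0 then 1 else 0)"
    by (auto simp: is_kernel_def)
  thus ?case by blast
next
  case (scale c a)
  then obtain K where K: "is_kernel q a K" ..
  have "finite {d. smult c (K d) \<noteq> 0}"
    by (rule finite_subset[of _ "{d. K d \<noteq> 0}"]) (use K in \<open>auto simp: is_kernel_def\<close>)
  with K have "is_kernel q (free_const c * a) (\<lambda>d. smult c (K d))"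
    by (auto simp: is_kernel_def free_act_const_mult)
  thus ?case by blast
next
  case (add a b)
  then obtain K H where KH: "is_kernel q a K" "is_kernel q b H" by blast
  have "finite {d. K d + H d \<noteq> 0}"
    by (rule finite_subset[of _ "{d. K d \<noteq> 0} \<union> {d. H d \<noteq> 0}"]) (use KH in \<open>auto simp: is_kernel_def\<close>)
  with KH have "is_kernel q (a + b) (\<lambda>d. K d + H d)"
    by (auto simp: is_kernel_def free_act_add)
  thus ?case by blast
next
  case (gen l a)
  thus ?case using is_kernel_gen_LX is_kernel_gen_LY[OF q] by (cases l) blast+
qed

section \<open>Comparing degrees in products: units and images of the generators\<close>

text \<open>Matrix multiplication in the basis t^n. The free choice of \<open>A\<close> allows a
  single intermediate power to be isolated.\<close>

lemma coeff_free_act_mult: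
  assumes "finite A"
    and "\<And>k. k \<notin> A \<Longrightarrow> coeff (free_act q b (monom 1 n)) k * coeff (free_act q a (monom 1 k)) m = 0"
  shows "coeff (free_act q (a * b) (monom 1 n)) m =
    (\<Sum>k\<in>A. coeff (free_act q b (monom 1 n)) k * coeff (free_act q a (monom 1 k)) m)"
proof -
  let ?p = "free_act q b (monom 1 n)"
  have "free_act q (a * b) (monom 1 n) = free_act q a (\<Sum>k\<le>degree ?p. smult (coeff ?p k) (monom 1 k))"
    by (simp add: free_act_mult smult_monom poly_as_sum_of_monoms)
  hence "coeff (free_act q (a * b) (monom 1 n)) m =
      (\<Sum>k\<le>degree ?p. coeff ?p k * coeff (free_act q a (monom 1 k)) m)"
    by (simp add: free_act_sum_right free_act_smult coeff_sum)
  also have "\<dots> = (\<Sum>k\<in>{..degree ?p} \<union> A. coeff ?p k * coeff (free_act q a (monom 1 k)) m)"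
    using assms(1) by (intro sum.mono_neutral_left) (auto simp: coeff_eq_0)
  also have "\<dots> = (\<Sum>k\<in>A. coeff ?p k * coeff (free_act q a (monom 1 k)) m)"
    using assms by (intro sum.mono_neutral_right) auto
  finally show ?thesis .
qed

lemma power_eq_iff_of_generic:
  fixes q :: "'k::field"
  assumes q: "q \<noteq> 0" "\<And>n. n > 0 \<Longrightarrow> q ^ n \<noteq> 1"
  shows "q ^ m = q ^ n \<longleftrightarrow> m = n"
proof
  have *: "m = n" if "m \<le> n" "q ^ m = q ^ n" for m n
  proof -
    have "q ^ m * q ^ (n - m) = q ^ n" using that(1) by (simp flip: power_add)
    hence "q ^ m * q ^ (n - m) = q ^ m * 1" by (simp only: that(2) mult_1_right)
    hence "q ^ (n - m) = 1" using q(1) by simp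
    thus ?thesis using q(2)[of "n - m"] that(1) by (cases "m < n") auto
  qed
  show "m = n" if "q ^ m = q ^ n"
    using *[of m n] *[of n m] that by (cases "m \<le> n") auto
qed simp

text \<open>The powers of \<open>q\<close> from \<open>N\<close> on are infinitely many distinct
  points. The threshold lets one skip small exponents that a negative degree would push below
  0.\<close>

lemma poly_eq_on_powers:
  fixes q :: "'k::field"
  assumes q: "q \<noteq> 0" "\<And>n. n > 0 \<Longrightarrow> q ^ n \<noteq> 1"
    and eq: "\<And>n. n \<ge> N \<Longrightarrow> poly f (q ^ n) = poly g (q ^ n)"
  shows "f = g"
proof (rule ccontr)
  assume "f \<noteq> g"
  hence "finite {x. poly (f - g) x = 0}" by (intro poly_roots_finite) simp
  moreover have "(\<lambda>n. q ^ n) ` {N..} \<subseteq> {x. poly (f - g) x = 0}" using eq by auto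
  ultimately have "finite ((\<lambda>n. q ^ n) ` {N..})" by (rule finite_subset[rotated])
  moreover have "inj_on (\<lambda>n. q ^ n) {N..}"
    by (rule inj_onI) (simp only: power_eq_iff_of_generic[OF q])
  ultimately show False using finite_imageD infinite_Ici by blast
qed

text \<open>
  With \<open>s = 1\<close> this compares top degrees and with \<open>s = - 1\<close> bottom degrees: in either case the
  extremal components of two operators cannot cancel in the product.
\<close>

lemma kernel_extremal_degrees:
  fixes q :: "'k::field" and s :: int
  assumes q: "q \<noteq> 0" "\<And>n. n > 0 \<Longrightarrow> q ^ n \<noteq> 1"
    and K: "is_kernel q a K" and H: "is_kernel q b H" and ab: "free_act q (a * b) = free_act q 1"
    and s: "s \<noteq> 0" and d: "K d \<noteq> 0" and e: "H e \<noteq> 0"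
    and dmax: "\<And>d'. K d' \<noteq> 0 \<Longrightarrow> s * d' \<le> s * d" and emax: "\<And>e'. H e' \<noteq> 0 \<Longrightarrow> s * e' \<le> s * e"
  shows "d + e = 0"
proof (rule ccontr)
  assume ne: "d + e \<noteq> 0"
  \<comment> \<open>The component of degree \<open>d + e\<close> of the product: t^n goes to t^(n+e)
    with factor \<open>H e\<close> at q^n, then on with factor \<open>K d\<close> at
    q^(n+e).\<close>
  let ?G = "H e * pcompose (K d) [:0, q powi e:]"
  have *: "poly ?G (q ^ n) = poly 0 (q ^ n)" if n: "n \<ge> nat (\<bar>d\<bar> + \<bar>e\<bar>)" for n
  proof -
    \<comment> \<open>The bound on \<open>n\<close> keeps both exponents nonnegative, so
      \<open>nat\<close> loses nothing.\<close>
    define k m where "k = nat (int n + e)" and "m = nat (int n + d + e)"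
    have k: "int k = int n + e" and m: "int m = int n + d + e" using n by (auto simp: k_def m_def)
    have "coeff (free_act q (a * b) (monom 1 n)) m =
        (\<Sum>j\<in>{k}. coeff (free_act q b (monom 1 n)) j * coeff (free_act q a (monom 1 j)) m)"
    proof (rule coeff_free_act_mult)
      fix j assume j: "j \<notin> {k}"
      show "coeff (free_act q b (monom 1 n)) j * coeff (free_act q a (monom 1 j)) m = 0"
      proof (rule ccontr)
        assume "coeff (free_act q b (monom 1 n)) j * coeff (free_act q a (monom 1 j)) m \<noteq> 0"
        hence "H (int j - int n) \<noteq> 0" "K (int m - int j) \<noteq> 0"
          using K H by (auto simp: is_kernel_def)
        \<comment> \<open>The two bounds say that s (j - k) is at most 0 and at least 0.\<close>
        hence "s * (int j - int n) \<le> s * e" "s * (int m - int j) \<le> s * d"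
          using dmax emax by blast+
        hence "s * (int j - int k) = 0" unfolding m k by (simp add: algebra_simps)
        thus False using s j by simp
      qed
    qed simp
    also have "\<dots> = poly (H e) (q ^ n) * poly (K d) (q ^ k)"
      using K H by (simp add: is_kernel_def k m)
    also have "q ^ k = q powi e * q ^ n"
    proof -
      have "q ^ k = q powi (e + int n)" by (simp add: k add.commute flip: power_int_of_nat)
      thus ?thesis using q by (simp add: power_int_add)
    qed
    also have "coeff (free_act q (a * b) (monom 1 n)) m = 0"
      using ne m by (simp add: ab)
    finally show ?thesis by (simp add: poly_pcompose mult.commute)
  qed
  have "?G = 0" by (rule poly_eq_on_powers[OF q *])
  hence "pcompose (K d) [:0, q powi e:] = 0" using e by simp
  moreover have "degree [:0, q powi e:] > 0" using q by simp
  ultimately show False using d by (simp add: pcompose_eq_0_iff)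
qed

text \<open>The highest degrees of \<open>a\<close> and its inverse \<open>b\<close> add up to 0,
  and so do the lowest, hence both are homogeneous. Neither kills the polynomial 1, so both degrees
  are nonnegative and thus 0. There the components are polynomials with product 1, hence
  constants.\<close>

lemma free_act_unit_is_const:
  fixes q :: "'k::field"
  assumes q: "q \<noteq> 0" "\<And>n. n > 0 \<Longrightarrow> q ^ n \<noteq> 1"
    and ab: "free_act q (a * b) = free_act q 1" and ba: "free_act q (b * a) = free_act q 1"
  shows "\<exists>c. free_act q a = free_act q (free_const c)"
proof -
  have q1: "q \<noteq> 1" using q(2)[of 1] by simp
  obtain K H where K: "is_kernel q a K" and H: "is_kernel q b H"
    using is_kernel_exists[OF q(1) q1] by blast
  have a0: "free_act q a (monom 1 0) \<noteq> 0"
    using fun_cong[OF ba, of "monom 1 0"] by (auto simp: free_act_mult)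
  have b0: "free_act q b (monom 1 0) \<noteq> 0"
    using fun_cong[OF ab, of "monom 1 0"] by (auto simp: free_act_mult)
  obtain m where m: "coeff (free_act q a (monom 1 0)) m \<noteq> 0"
    using a0 by (auto simp: poly_eq_iff)
  obtain m' where m': "coeff (free_act q b (monom 1 0)) m' \<noteq> 0"
    using b0 by (auto simp: poly_eq_iff)
  have Km: "K (int m) \<noteq> 0" using K m by (auto simp: is_kernel_def simp del: monom_eq_1)
  have Hm: "H (int m') \<noteq> 0" using H m' by (auto simp: is_kernel_def simp del: monom_eq_1)
  let ?D = "{d. K d \<noteq> 0}" and ?E = "{e. H e \<noteq> 0}"
  have D: "finite ?D" "?D \<noteq> {}" using K Km by (auto simp: is_kernel_def)
  have E: "finite ?E" "?E \<noteq> {}" using H Hm by (auto simp: is_kernel_def)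
  have maxs: "Max ?D + Max ?E = 0"
    using Max_in[OF D] Max_in[OF E] Max_ge[OF D(1)] Max_ge[OF E(1)]
    by (intro kernel_extremal_degrees[OF q K H ab, of 1]) auto
  have mins: "Min ?D + Min ?E = 0"
    using Min_in[OF D] Min_in[OF E] Min_le[OF D(1)] Min_le[OF E(1)]
    by (intro kernel_extremal_degrees[OF q K H ab, of "- 1"]) auto
  have bounds: "Min ?D \<le> d" "d \<le> Max ?D" if "K d \<noteq> 0" for d
    using that Min_le[OF D(1)] Max_ge[OF D(1)] by auto
  have bounds': "Min ?E \<le> d" "d \<le> Max ?E" if "H d \<noteq> 0" for d
    using that Min_le[OF E(1)] Max_ge[OF E(1)] by auto
  have K0: "d = 0" if "K d \<noteq> 0" for d
    using maxs mins bounds[OF that] bounds[OF Km] bounds'[OF Hm] by linarith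
  have H0: "d = 0" if "H d \<noteq> 0" for d
    using maxs mins bounds'[OF that] bounds[OF Km] bounds'[OF Hm] by linarith
  have "poly (H 0 * K 0) (q ^ n) = poly 1 (q ^ n)" for n
  proof -
    have "coeff (free_act q (a * b) (monom 1 n)) n =
        (\<Sum>j\<in>{n}. coeff (free_act q b (monom 1 n)) j * coeff (free_act q a (monom 1 j)) n)"
    proof (rule coeff_free_act_mult)
      fix k assume "k \<notin> {n}"
      hence "H (int k - int n) = 0" using H0[of "int k - int n"] by auto
      thus "coeff (free_act q b (monom 1 n)) k * coeff (free_act q a (monom 1 k)) n = 0"
        using H by (simp add: is_kernel_def)
    qed simp
    thus ?thesis using K H by (simp add: ab is_kernel_def)
  qed
  hence 1: "H 0 * K 0 = 1" by (intro poly_eq_on_powers[OF q])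
  hence "K 0 \<noteq> 0" "H 0 \<noteq> 0" by auto
  hence "degree (K 0) = 0" using arg_cong[OF 1, of degree] by (simp add: degree_mult_eq)
  then obtain c where c: "K 0 = [:c:]" by (auto elim: degree_eq_zeroE)
  have "free_act q a = free_act q (free_const c)"
  proof (rule free_act_ext, rule poly_eqI)
    fix n m
    have "coeff (free_act q a (monom 1 n)) m = poly (K (int m - int n)) (q ^ n)"
      using K by (simp add: is_kernel_def)
    moreover have "K (int m - int n) = 0" if "m \<noteq> n"
      by (rule ccontr) (use K0[of "int m - int n"] that in simp)
    ultimately show "coeff (free_act q a (monom 1 n)) m = coeff (free_act q (free_const c) (monom 1 n)) m"
      using c by (cases "m = n") auto
  qed
  thus ?thesis ..
qed

text \<open>
  The two commutation relations with \<open>z\<close> make \<open>a\<close> and \<open>b\<close> homogeneous of degrees \<open>1\<close> and \<open>- 1\<close>;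
  comparing degrees of polynomials in the third relation then leaves no choice but scalars.
\<close>

lemma free_act_generators_unique:
  fixes q :: "'k::field"
  assumes q: "q \<noteq> 0" "\<And>n. n > 0 \<Longrightarrow> q ^ n \<noteq> 1"
    and az: "free_act q (free_z * a) = free_act q (free_const q * (a * free_z))"
    and bz: "free_act q (b * free_z) = free_act q (free_const q * (free_z * b))"
    and ab: "free_act q (free_const (q - 1) * (a * b) + 1) = free_act q (free_const l * free_z)"
  shows "\<exists>\<beta>. \<beta> \<noteq> 0 \<and> free_act q a = free_act q (free_const (inverse \<beta>) * free_gen LX) \<and>
    free_act q b = free_act q (free_const \<beta> * free_gen LY)"
proof -
  have q1: "q \<noteq> 1" using q(2)[of 1] by simp
  obtain K H where K: "is_kernel q a K" and H: "is_kernel q b H"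
    using is_kernel_exists[OF q(1) q1] by blast
  have mz: "free_act q free_z (monom 1 n) = smult (q ^ n) (monom 1 n)" for n
    by (simp add: free_act_z_monom[OF q1] smult_monom)
  \<comment> \<open>Both sides of \<open>az\<close>, applied to t^n, are compared through the
    eigenvalues q^m of z, which are pairwise distinct.\<close>
  have a1: "m = Suc n" if "coeff (free_act q a (monom 1 n)) m \<noteq> 0" for m n
  proof -
    have "q ^ m * coeff (free_act q a (monom 1 n)) m = q ^ Suc n * coeff (free_act q a (monom 1 n)) m"
      using arg_cong[OF fun_cong[OF az, of "monom 1 n"], of "\<lambda>p. coeff p m"]
      by (simp add: free_act_mult free_act_const_mult coeff_free_act_z[OF q1] mz free_act_smult mult_ac)
    with that show ?thesis by (simp only: mult_cancel_right power_eq_iff_of_generic[OF q]) blast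
  qed
  have b1: "n = Suc m" if "coeff (free_act q b (monom 1 n)) m \<noteq> 0" for m n
  proof -
    have "q ^ n * coeff (free_act q b (monom 1 n)) m = q ^ Suc m * coeff (free_act q b (monom 1 n)) m"
      using arg_cong[OF fun_cong[OF bz, of "monom 1 n"], of "\<lambda>p. coeff p m"]
      by (simp add: free_act_mult free_act_const_mult coeff_free_act_z[OF q1] mz free_act_smult mult_ac)
    with that show ?thesis by (simp only: mult_cancel_right power_eq_iff_of_generic[OF q]) blast
  qed
  have ac: "free_act q a (monom 1 n) = monom (poly (K 1) (q ^ n)) (Suc n)" for n
  proof (rule poly_eqI)
    fix m
    show "coeff (free_act q a (monom 1 n)) m = coeff (monom (poly (K 1) (q ^ n)) (Suc n)) m"
      using a1[of n m] K by (cases "m = Suc n") (auto simp: is_kernel_def)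
  qed
  have bc: "free_act q b (monom 1 (Suc n)) = monom (poly (H (- 1)) (q ^ Suc n)) n" for n
  proof (rule poly_eqI)
    fix m
    show "coeff (free_act q b (monom 1 (Suc n))) m = coeff (monom (poly (H (- 1)) (q ^ Suc n)) n) m"
      using b1[of "Suc n" m] H by (cases "m = n") (auto simp: is_kernel_def)
  qed
  have b0: "free_act q b (monom 1 0) = 0"
    by (rule poly_eqI) (use b1[of 0] in force)
  \<comment> \<open>At t^0, which \<open>b\<close> kills, the third relation reads 1 = l.\<close>
  have l: "l = 1"
    using arg_cong[OF fun_cong[OF ab, of "monom 1 0"], of "\<lambda>p. coeff p 0"] b0
    by (simp add: free_act_mult free_act_add free_act_const_mult coeff_free_act_z[OF q1] del: monom_eq_1)
  have rel: "(q - 1) * (poly (H (- 1)) (q ^ Suc n) * poly (K 1) (q ^ n)) + 1 = q ^ Suc n" for n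
  proof -
    have "free_act q a (monom c n) = smult c (free_act q a (monom 1 n))" for c n
      by (simp add: smult_monom flip: free_act_smult)
    thus ?thesis
      using arg_cong[OF fun_cong[OF ab, of "monom 1 (Suc n)"], of "\<lambda>p. coeff p (Suc n)"]
      by (simp add: l free_act_mult free_act_add free_act_const_mult coeff_free_act_z[OF q1] bc ac
        mult.assoc del: monom_eq_1)
  qed
  \<comment> \<open>In a b the factor of \<open>b\<close> is taken at q^(n+1) and that of
    \<open>a\<close> at q^n; substituting q times the variable makes both polynomials in
    q^n.\<close>
  let ?g = "pcompose (H (- 1)) [:0, q:]"
  have eq: "smult (q - 1) (K 1 * ?g) = [:- 1, q:]"
  proof (rule poly_eq_on_powers[OF q])
    fix n
    show "poly (smult (q - 1) (K 1 * ?g)) (q ^ n) = poly [:- 1, q:] (q ^ n)"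
      using rel[of n] by (simp add: poly_pcompose algebra_simps)
  qed
  have ne: "K 1 \<noteq> 0" "?g \<noteq> 0" using eq q by auto
  have "degree (K 1) + degree ?g = 1"
    using arg_cong[OF eq, of degree] ne q q1 by (simp add: degree_mult_eq)
  \<comment> \<open>Since t^0 cannot be lowered, \<open>H (- 1)\<close> vanishes at 1; being
    nonzero, it is not constant. It takes up the whole degree 1, which leaves \<open>K 1\<close>
    constant.\<close>
  moreover have "degree (H (- 1)) \<noteq> 0"
  proof
    assume "degree (H (- 1)) = 0"
    then obtain c where c: "H (- 1) = [:c:]" by (auto elim: degree_eq_zeroE)
    have "int 0 + (- 1) < 0" by simp
    with H have "poly (H (- 1)) (q ^ 0) = 0" unfolding is_kernel_def by blast
    with c ne(2) show False by simp
  qed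
  ultimately have "degree (K 1) = 0" using q by (simp add: degree_pcompose)
  then obtain \<alpha> where \<alpha>: "K 1 = [:\<alpha>:]" by (auto elim: degree_eq_zeroE)
  have \<alpha>0: "\<alpha> \<noteq> 0" using ne \<alpha> by auto
  have "free_act q a = free_act q (free_const \<alpha> * free_gen LX)"
    by (rule free_act_ext)
      (simp add: ac \<alpha> free_act_const_mult letter_act_LX_monom smult_monom del: letter_act.simps)
  moreover have "free_act q b = free_act q (free_const (inverse \<alpha>) * free_gen LY)"
  proof (rule free_act_ext)
    fix n
    show "free_act q b (monom 1 n) = free_act q (free_const (inverse \<alpha>) * free_gen LY) (monom 1 n)"
    proof (cases n)
      case 0
      thus ?thesis using b0
        by (simp add: free_act_const_mult letter_act_LY_monom del: letter_act.simps monom_eq_1)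
    next
      case (Suc m)
      have "poly (H (- 1)) (q ^ Suc m) = inverse \<alpha> * qint q (Suc m)"
        using rel[of m] \<alpha>0 q1 by (simp add: \<alpha> qint_def field_simps)
      thus ?thesis unfolding Suc
        by (simp add: bc free_act_const_mult letter_act_LY_monom smult_monom del: letter_act.simps)
    qed
  qed
  ultimately show ?thesis using \<alpha>0 by (intro exI[of _ "inverse \<alpha>"]) simp
qed

section \<open>The torus of automorphisms\<close>

text \<open>For nonzero \<beta>, \<open>b\<close> acts as the conjugate of \<open>a\<close> by the
  substitution of t / \<beta> for t. This is a relation because only the action of \<open>b\<close>
  is determined; speaking of actions also makes it compatible with the defining ideal.\<close>

definition torus_related :: "'k::field \<Rightarrow> 'k \<Rightarrow> 'k free_alg \<Rightarrow> 'k free_alg \<Rightarrow> bool"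
  where "torus_related q \<beta> a b \<longleftrightarrow>
    (\<forall>p. free_act q b (pcompose p [:0, inverse \<beta>:]) = pcompose (free_act q a p) [:0, inverse \<beta>:])"

lemma torus_related_mult:
  "torus_related q \<beta> a b \<Longrightarrow> torus_related q \<beta> a' b' \<Longrightarrow> torus_related q \<beta> (a * a') (b * b')"
  by (simp add: torus_related_def free_act_mult)

lemma torus_related_add:
  "torus_related q \<beta> a b \<Longrightarrow> torus_related q \<beta> a' b' \<Longrightarrow> torus_related q \<beta> (a + a') (b + b')"
  by (simp add: torus_related_def free_act_add pcompose_add)

lemma torus_related_const: "torus_related q \<beta> (free_const c) (free_const c)"
  by (simp add: torus_related_def pcompose_smult)

lemma torus_related_1: "torus_related q \<beta> 1 1"
  by (simp add: torus_related_def)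

lemma torus_related_0: "torus_related q \<beta> 0 0"
  by (simp add: torus_related_def)

lemma torus_related_sum:
  "(\<And>i. i \<in> A \<Longrightarrow> torus_related q \<beta> (f i) (g i)) \<Longrightarrow> torus_related q \<beta> (\<Sum>i\<in>A. f i) (\<Sum>i\<in>A. g i)"
  by (induction A rule: infinite_finite_induct) (auto simp: torus_related_0 torus_related_add)

definition torus_weight :: "'k::field \<Rightarrow> letter \<Rightarrow> 'k"
  where "torus_weight \<beta> l = (case l of LX \<Rightarrow> inverse \<beta> | LY \<Rightarrow> \<beta>)"

lemma torus_related_gen:
  assumes "\<beta> \<noteq> 0"
  shows "torus_related q \<beta> (free_gen l) (free_const (torus_weight \<beta> l) * free_gen l)"
proof (cases l)
  case LX
  show ?thesis unfolding LX
    by (auto simp: torus_related_def torus_weight_def free_act_const_mult pcompose_pCons)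
next
  case LY
  show ?thesis unfolding LY torus_related_def
    using assms
    by (auto intro!: poly_eqI simp: torus_weight_def free_act_const_mult coeff_qderiv
        coeff_pcompose_linear field_simps)
qed

lemma torus_related_gen_power:
  assumes "\<beta> \<noteq> 0"
  shows "torus_related q \<beta> (free_gen l ^ n) (free_const (torus_weight \<beta> l ^ n) * free_gen l ^ n)"
proof (induction n)
  case 0
  show ?case by (simp add: free_const_simps torus_related_1)
next
  case (Suc n)
  have "free_const (torus_weight \<beta> l ^ Suc n) * free_gen l ^ Suc n =
      (free_const (torus_weight \<beta> l) * free_gen l) * (free_const (torus_weight \<beta> l ^ n) * free_gen l ^ n)"
    by (simp add: free_const_simps mult.assoc free_const_left_commute[of "free_gen l"])
  with torus_related_mult[OF torus_related_gen[OF assms] Suc.IH] show ?case by simp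
qed

text \<open>x has weight \<open>inverse \<beta>\<close> and y has weight \<beta>. The differences j
  - i collected in S are therefore the weights that occur in w.\<close>

lemma torus_related_pbw_monom:
  assumes "\<beta> \<noteq> 0"
  shows "torus_related q \<beta> (pbw_monom i j) (free_const (\<beta> powi (int j - int i)) * pbw_monom i j)"
proof -
  have e: "\<beta> powi (int j - int i) = torus_weight \<beta> LX ^ i * torus_weight \<beta> LY ^ j"
    using assms by (simp add: power_int_diff torus_weight_def power_inverse divide_inverse)
  have "free_const (\<beta> powi (int j - int i)) * pbw_monom i j =
      (free_const (torus_weight \<beta> LX ^ i) * free_gen LX ^ i)
      * (free_const (torus_weight \<beta> LY ^ j) * free_gen LY ^ j)"
    unfolding e by (simp add: pbw_monom_def free_const_simps mult.assoc
        free_const_left_commute[of "free_gen LX ^ i"])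
  with torus_related_mult[OF torus_related_gen_power[OF assms, of q LX i]
      torus_related_gen_power[OF assms, of q LY j]]
  show ?thesis by (simp add: pbw_monom_def)
qed

lemma torus_related_pbw_sum:
  assumes "\<beta> \<noteq> 0"
  shows "torus_related q \<beta> (pbw_sum c) (pbw_sum (\<lambda>p. c p * \<beta> powi (int (snd p) - int (fst p))))"
proof -
  have "{p. c p * \<beta> powi (int (snd p) - int (fst p)) \<noteq> 0} = {p. c p \<noteq> 0}"
    using assms by auto
  thus ?thesis
    using assms unfolding pbw_sum_def
    by (auto simp: free_const_simps mult.assoc intro!: torus_related_sum torus_related_mult
        torus_related_const torus_related_pbw_monom)
qed

lemma torus_related_exists:
  assumes "\<beta> \<noteq> 0"
  shows "\<exists>b. torus_related q \<beta> a b"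
  using torus_related_gen[OF assms]
  by (induction a rule: free_alg_induct)
    (blast intro: torus_related_1 torus_related_add torus_related_mult torus_related_const)+

text \<open>The substitution is onto, with \<open>pcompose p [:0, \<beta>:]\<close> as preimage of
  \<open>p\<close>, so the action of \<open>a\<close> determines that of \<open>b\<close>. This
  makes \<open>torus\<close> well defined on classes.\<close>

lemma torus_related_unique:
  assumes "\<beta> \<noteq> 0" "torus_related q \<beta> a b" "torus_related q \<beta> a' b'" "free_act q a = free_act q a'"
  shows "free_act q b = free_act q b'"
proof
  fix p
  have "pcompose (pcompose p [:0, \<beta>:]) [:0, inverse \<beta>:] = p"
    using assms(1) by (intro poly_eqI) (simp add: coeff_pcompose_linear power_inverse)
  thus "free_act q b p = free_act q b' p"
    using assms(2-4) unfolding torus_related_def by metis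
qed

lemma torus_related_comp:
  assumes "torus_related q \<beta> a b" "torus_related q \<gamma> b c"
  shows "torus_related q (\<beta> * \<gamma>) a c"
proof -
  have "pcompose p [:0, inverse (\<beta> * \<gamma>):] = pcompose (pcompose p [:0, inverse \<beta>:]) [:0, inverse \<gamma>:]"
    for p :: "'a poly"
    by (intro poly_eqI) (simp add: coeff_pcompose_linear power_mult_distrib power_inverse)
  thus ?thesis using assms by (simp add: torus_related_def)
qed

lemma torus_related_refl: "torus_related q 1 a a"
proof -
  have "pcompose p [:0, inverse 1:] = p" for p :: "'a poly"
    by (intro poly_eqI) (simp add: coeff_pcompose_linear)
  thus ?thesis by (simp add: torus_related_def)
qed

section \<open>Transfer to the quotient algebra\<close>

lemma qweyl_class_diff: "qweyl_class q (a - b) = qweyl_class q a \<ominus>\<^bsub>qweyl q\<^esub> qweyl_class q b"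
proof -
  interpret R: ring "qweyl q" by (rule ring_qweyl)
  have "qweyl_class q a = qweyl_class q (a - b) \<oplus>\<^bsub>qweyl q\<^esub> qweyl_class q b"
    by (simp flip: qweyl_class_add)
  thus ?thesis by (simp add: R.minus_eq R.a_assoc R.r_neg)
qed

lemma qweyl_class_power: "qweyl_class q (a ^ n) = qweyl_class q a [^]\<^bsub>qweyl q\<^esub> n"
proof -
  interpret R: ring "qweyl q" by (rule ring_qweyl)
  show ?thesis
    by (induction n) (simp_all add: qweyl_class_one power_Suc2 qweyl_class_mult del: power_Suc)
qed

lemma qweyl_class_sum:
  "finite A \<Longrightarrow> qweyl_class q (\<Sum>i\<in>A. f i) = (\<Oplus>\<^bsub>qweyl q\<^esub>i\<in>A. qweyl_class q (f i))"
proof (induction A rule: finite_induct)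
  interpret R: ring "qweyl q" by (rule ring_qweyl)
  {
    case empty
    have "qweyl_class q 0 = \<zero>\<^bsub>qweyl q\<^esub>"
      using qweyl_class_diff[of q 0 0] by (simp add: R.minus_eq R.r_neg)
    thus ?case by simp
  next
    case (insert i A)
    thus ?case by (simp add: qweyl_class_add)
  }
qed

lemma qweyl_monom_eq_class: "qweyl_monom q i j = qweyl_class q (pbw_monom i j)"
  by (simp add: qweyl_monom_def pbw_monom_def qweyl_class_mult qweyl_class_power qweyl_x_def qweyl_y_def)

lemma pbw_sum_class:
  assumes "finite {p. c p \<noteq> 0}"
  shows "qweyl_class q (pbw_sum c) = (\<Oplus>\<^bsub>qweyl q\<^esub>p\<in>{p. c p \<noteq> 0}.
    qweyl_scale q (c p) (qweyl_monom q (fst p) (snd p)))"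
  using assms by (simp add: pbw_sum_def qweyl_class_sum qweyl_class_const_mult qweyl_monom_eq_class)

lemma free_const_diff: "free_const (a - b) = free_const a - free_const b"
  using free_const_simps(3)[of "a - b" b] by (simp add: eq_diff_eq)

lemma pbw_sum_diff:
  assumes "finite {p. c p \<noteq> 0}" "finite {p. d p \<noteq> 0}"
  shows "pbw_sum (\<lambda>p. c p - d p) = pbw_sum c - pbw_sum d"
proof -
  have fin: "finite ({p. c p \<noteq> 0} \<union> {p. d p \<noteq> 0})" using assms by simp
  show ?thesis
    by (subst (1 2 3) pbw_sum_superset[OF fin]) (auto simp: free_const_diff left_diff_distrib sum_subtractf)
qed

locale generic_qweyl =
  fixes q :: "'k::field"
  assumes q_neq_0: "q \<noteq> 0" and q_generic: "n > 0 \<Longrightarrow> q ^ n \<noteq> 1"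
begin

sublocale R: ring "qweyl q" by (rule ring_qweyl)

abbreviation "C \<equiv> carrier (qweyl q)"

lemma q_neq_1: "q \<noteq> 1"
  using q_generic[of 1] by simp

lemma class_eq_iff: "qweyl_class q a = qweyl_class q b \<longleftrightarrow> free_act q a = free_act q b"
  by (rule qweyl_class_eq_iff[OF q_generic])

lemma pbw_sum_inj:
  assumes fin: "finite {p. c p \<noteq> 0}" "finite {p. d p \<noteq> 0}"
    and eq: "qweyl_class q (pbw_sum c) = qweyl_class q (pbw_sum d)"
  shows "c = d"
proof
  fix p
  have "finite {p. c p - d p \<noteq> 0}"
    by (rule finite_subset[of _ "{p. c p \<noteq> 0} \<union> {p. d p \<noteq> 0}"]) (use fin in auto)
  moreover have "free_act q (pbw_sum (\<lambda>p. c p - d p)) = free_act q 0"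
    using eq by (simp add: class_eq_iff pbw_sum_diff[OF fin] fun_eq_iff free_act_minus)
  ultimately have "c p - d p = 0" using pbw_sum_independent[of q "\<lambda>p. c p - d p" p] q_generic by blast
  thus "c p = d p" by simp
qed

text \<open>The choice is immaterial by \<open>torus_related_unique\<close>. Restricting to
  \<open>C\<close> makes the map extensional, as \<open>Bij\<close> demands.\<close>

definition torus :: "'k \<Rightarrow> 'k free_alg set \<Rightarrow> 'k free_alg set"
  where "torus \<beta> = (\<lambda>r\<in>C. SOME s. \<exists>a b. r = qweyl_class q a \<and> s = qweyl_class q b \<and> torus_related q \<beta> a b)"

lemma torus_class:
  assumes "\<beta> \<noteq> 0" "torus_related q \<beta> a b"
  shows "torus \<beta> (qweyl_class q a) = qweyl_class q b"
proof -
  let ?P = "\<lambda>s. \<exists>a' b. qweyl_class q a = qweyl_class q a' \<and> s = qweyl_class q b \<and> torus_related q \<beta> a' b"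
  have "?P (qweyl_class q b)" using assms by blast
  hence "?P (SOME s. ?P s)" by (rule someI)
  then obtain a' b' where *: "qweyl_class q a = qweyl_class q a'" "(SOME s. ?P s) = qweyl_class q b'"
    "torus_related q \<beta> a' b'" by blast
  have "qweyl_class q b' = qweyl_class q b"
    using *(1) torus_related_unique[OF assms(1) *(3) assms(2)] by (simp add: class_eq_iff)
  thus ?thesis using *(2) by (simp add: torus_def)
qed

lemma torus_cases:
  assumes "\<beta> \<noteq> 0" "r \<in> C"
  obtains a b where "r = qweyl_class q a" "torus_related q \<beta> a b" "torus \<beta> (qweyl_class q a) = qweyl_class q b"
proof -
  obtain a where a: "r = qweyl_class q a" using qweyl_class_surj[OF assms(2)] .
  obtain b where b: "torus_related q \<beta> a b" using torus_related_exists[OF assms(1)] by blast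
  show thesis using that[OF a b] torus_class[OF assms(1) b] .
qed

lemma torus_closed: "\<beta> \<noteq> 0 \<Longrightarrow> r \<in> C \<Longrightarrow> torus \<beta> r \<in> C"
  by (erule (1) torus_cases) simp

lemma torus_comp:
  assumes "\<beta> \<noteq> 0" "\<gamma> \<noteq> 0" "r \<in> C"
  shows "torus \<gamma> (torus \<beta> r) = torus (\<beta> * \<gamma>) r"
proof -
  obtain a b where ab: "r = qweyl_class q a" "torus_related q \<beta> a b" "torus \<beta> (qweyl_class q a) = qweyl_class q b"
    using torus_cases[OF assms(1,3)] .
  obtain c where c: "torus_related q \<gamma> b c" using torus_related_exists[OF assms(2)] by blast
  show ?thesis
    using torus_class[OF assms(2) c] torus_class[OF _ torus_related_comp[OF ab(2) c]] assms ab by simp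
qed

lemma torus_1: "torus 1 = (\<lambda>r\<in>C. r)"
proof
  fix r
  show "torus 1 r = (\<lambda>r\<in>C. r) r"
  proof (cases "r \<in> C")
    case True
    then obtain a where "r = qweyl_class q a" by (rule qweyl_class_surj)
    thus ?thesis using torus_class[OF _ torus_related_refl] by simp
  qed (simp add: torus_def)
qed

lemma torus_Bij: "\<beta> \<noteq> 0 \<Longrightarrow> torus \<beta> \<in> Bij C"
  unfolding Bij_def
  by (auto intro!: bij_betwI[of _ _ _ "torus (inverse \<beta>)"] simp: torus_closed torus_comp torus_1)
    (simp add: torus_def extensional_def)

lemma torus_ring_hom:
  assumes "\<beta> \<noteq> 0"
  shows "torus \<beta> \<in> ring_hom (qweyl q) (qweyl q)"
proof (rule ring_hom_memI)
  fix r s assume rs: "r \<in> C" "s \<in> C"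
  obtain a b where ab: "r = qweyl_class q a" "torus_related q \<beta> a b" "torus \<beta> (qweyl_class q a) = qweyl_class q b"
    using torus_cases[OF assms rs(1)] .
  obtain a' b' where ab': "s = qweyl_class q a'" "torus_related q \<beta> a' b'" "torus \<beta> (qweyl_class q a') = qweyl_class q b'"
    using torus_cases[OF assms rs(2)] .
  show "torus \<beta> r \<in> C" by (rule torus_closed[OF assms rs(1)])
  show "torus \<beta> (r \<otimes>\<^bsub>qweyl q\<^esub> s) = torus \<beta> r \<otimes>\<^bsub>qweyl q\<^esub> torus \<beta> s"
    using torus_class[OF assms torus_related_mult[OF ab(2) ab'(2)]] by (simp add: ab ab' qweyl_class_mult)
  show "torus \<beta> (r \<oplus>\<^bsub>qweyl q\<^esub> s) = torus \<beta> r \<oplus>\<^bsub>qweyl q\<^esub> torus \<beta> s"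
    using torus_class[OF assms torus_related_add[OF ab(2) ab'(2)]] by (simp add: ab ab' qweyl_class_add)
next
  show "torus \<beta> \<one>\<^bsub>qweyl q\<^esub> = \<one>\<^bsub>qweyl q\<^esub>"
    using torus_class[OF assms torus_related_1] by (simp add: qweyl_class_one)
qed

lemma torus_scale:
  assumes "\<beta> \<noteq> 0" "r \<in> C"
  shows "torus \<beta> (qweyl_scale q c r) = qweyl_scale q c (torus \<beta> r)"
proof -
  obtain a b where ab: "r = qweyl_class q a" "torus_related q \<beta> a b" "torus \<beta> (qweyl_class q a) = qweyl_class q b"
    using torus_cases[OF assms] .
  show ?thesis
    using torus_class[OF assms(1) torus_related_mult[OF torus_related_const ab(2)]]
    by (simp add: ab qweyl_class_const_mult)
qed

lemma torus_aut: "\<beta> \<noteq> 0 \<Longrightarrow> torus \<beta> \<in> qweyl_auts q"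
  using torus_ring_hom[of \<beta>]
  by (auto simp: qweyl_auts_def qweyl_linear_def torus_Bij torus_scale ring_hom_add)

lemma torus_x: "\<beta> \<noteq> 0 \<Longrightarrow> torus \<beta> (qweyl_x q) = qweyl_class q (free_const (inverse \<beta>) * free_gen LX)"
  using torus_class[OF _ torus_related_gen[of \<beta> q LX]] by (simp add: qweyl_x_def torus_weight_def)

lemma torus_y: "\<beta> \<noteq> 0 \<Longrightarrow> torus \<beta> (qweyl_y q) = qweyl_class q (free_const \<beta> * free_gen LY)"
  using torus_class[OF _ torus_related_gen[of \<beta> q LY]] by (simp add: qweyl_y_def torus_weight_def)

lemma torus_inj:
  assumes "\<beta> \<noteq> 0" "\<gamma> \<noteq> 0" "torus \<beta> = torus \<gamma>"
  shows "\<beta> = \<gamma>"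
proof -
  have "free_act q (free_const (inverse \<beta>) * free_gen LX) = free_act q (free_const (inverse \<gamma>) * free_gen LX)"
    using torus_x[OF assms(1)] torus_x[OF assms(2)] assms(3) by (simp flip: class_eq_iff)
  from fun_cong[OF this, of 1] show ?thesis by (simp add: free_act_const_mult)
qed

section \<open>Every automorphism lies in the torus\<close>

lemma aut_class_image:
  assumes "\<rho> \<in> qweyl_auts q"
  obtains a' where "\<rho> (qweyl_class q a) = qweyl_class q a'"
proof -
  have "\<rho> (qweyl_class q a) \<in> C"
    using assms by (auto simp: qweyl_auts_def intro: ring_hom_closed)
  from qweyl_class_surj[OF this] that show thesis by blast
qed

lemma aut_class_preimage:
  assumes "\<rho> \<in> qweyl_auts q"
  obtains a' where "\<rho> (qweyl_class q a') = qweyl_class q a"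
proof -
  have "\<rho> ` C = C" using assms by (simp add: qweyl_auts_def Bij_def bij_betw_def)
  then obtain r where "r \<in> C" "\<rho> r = qweyl_class q a"
    using qweyl_class_closed[of q a] by (metis imageE)
  thus thesis using that by (metis qweyl_class_surj)
qed

lemma aut_class_mult:
  assumes "\<rho> \<in> qweyl_auts q" "\<rho> (qweyl_class q a) = qweyl_class q a'" "\<rho> (qweyl_class q b) = qweyl_class q b'"
  shows "\<rho> (qweyl_class q (a * b)) = qweyl_class q (a' * b')"
  using assms ring_hom_mult[of \<rho> "qweyl q" "qweyl q" "qweyl_class q a" "qweyl_class q b"]
  by (simp add: qweyl_auts_def qweyl_class_mult)

lemma aut_class_add:
  assumes "\<rho> \<in> qweyl_auts q" "\<rho> (qweyl_class q a) = qweyl_class q a'" "\<rho> (qweyl_class q b) = qweyl_class q b'"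
  shows "\<rho> (qweyl_class q (a + b)) = qweyl_class q (a' + b')"
  using assms ring_hom_add[of \<rho> "qweyl q" "qweyl q" "qweyl_class q a" "qweyl_class q b"]
  by (simp add: qweyl_auts_def qweyl_class_add)

lemma aut_class_one: "\<rho> \<in> qweyl_auts q \<Longrightarrow> \<rho> (qweyl_class q 1) = qweyl_class q 1"
  by (auto simp: qweyl_auts_def qweyl_class_one dest: ring_hom_one)

lemma aut_class_scale:
  assumes "\<rho> \<in> qweyl_auts q" "\<rho> (qweyl_class q a) = qweyl_class q a'"
  shows "\<rho> (qweyl_class q (free_const c * a)) = qweyl_class q (free_const c * a')"
  using assms by (simp add: qweyl_auts_def qweyl_linear_def qweyl_class_const_mult)

lemma aut_class_diff:
  assumes "\<rho> \<in> qweyl_auts q" "\<rho> (qweyl_class q a) = qweyl_class q a'" "\<rho> (qweyl_class q b) = qweyl_class q b'"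
  shows "\<rho> (qweyl_class q (a - b)) = qweyl_class q (a' - b')"
  using aut_class_add[OF assms(1,2) aut_class_scale[OF assms(1,3), of "- 1"]]
  by (simp add: free_const_simps)

lemma aut_eqI:
  assumes \<rho>: "\<rho> \<in> qweyl_auts q" and \<tau>: "\<tau> \<in> qweyl_auts q"
    and x: "\<rho> (qweyl_x q) = \<tau> (qweyl_x q)" and y: "\<rho> (qweyl_y q) = \<tau> (qweyl_y q)"
  shows "\<rho> = \<tau>"
proof
  have gen_eq: "\<rho> (qweyl_class q (free_gen l)) = \<tau> (qweyl_class q (free_gen l))" for l
    using x y by (cases l) (simp_all add: qweyl_x_def qweyl_y_def)
  have cls: "\<exists>b. \<tau> (qweyl_class q a) = qweyl_class q b" for a
    using aut_class_image[OF \<tau>] by blast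
  have eq: "\<rho> (qweyl_class q a) = \<tau> (qweyl_class q a)" for a
  proof (induction a rule: free_alg_induct)
    case one
    show ?case by (simp add: aut_class_one \<rho> \<tau>)
  next
    case (scale c a)
    thus ?case using cls[of a] aut_class_scale[OF \<rho>, of a] aut_class_scale[OF \<tau>, of a] by auto
  next
    case (add a b)
    thus ?case
      using cls[of a] cls[of b] aut_class_add[OF \<rho>, of a _ b] aut_class_add[OF \<tau>, of a _ b] by auto
  next
    case (gen l a)
    thus ?case
      using cls[of "free_gen l"] cls[of a] gen_eq[of l]
        aut_class_mult[OF \<rho>, of "free_gen l" _ a] aut_class_mult[OF \<tau>, of "free_gen l" _ a] by auto
  qed
  fix r
  show "\<rho> r = \<tau> r"
  proof (cases "r \<in> C")
    case True
    thus ?thesis using eq by (auto elim: qweyl_class_surj)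
  next
    case False
    have "\<rho> \<in> extensional C" "\<tau> \<in> extensional C" using \<rho> \<tau> by (auto simp: qweyl_auts_def Bij_def)
    with False show ?thesis by (auto simp: extensional_def)
  qed
qed

text \<open>z acts diagonally with the nonzero eigenvalues q^n.\<close>

lemma free_act_z_cancel:
  assumes "free_act q (free_z * a) = free_act q (free_z * b)"
  shows "free_act q a = free_act q b"
proof (rule ext, rule poly_eqI)
  fix p n
  show "coeff (free_act q a p) n = coeff (free_act q b p) n"
    using arg_cong[OF fun_cong[OF assms, of p], of "\<lambda>p. coeff p n"] q_neq_0
    by (simp add: free_act_mult coeff_free_act_z[OF q_neq_1])
qed

text \<open>
  The commutator ideal is generated by \<open>z = yx - xy\<close>, hence preserved by every automorphism. So \<open>\<rho> z = z u\<close>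
  and \<open>\<rho>\<inverse> z = z v\<close>, which makes \<open>u\<close> a unit, hence a scalar.
\<close>

lemma aut_z:
  assumes \<rho>: "\<rho> \<in> qweyl_auts q"
  shows "\<exists>l. l \<noteq> 0 \<and> \<rho> (qweyl_class q free_z) = qweyl_class q (free_const l * free_z)"
proof -
  have inj: "qweyl_class q a = qweyl_class q b" if "\<rho> (qweyl_class q a) = \<rho> (qweyl_class q b)" for a b
  proof -
    have "inj_on \<rho> C" using \<rho> by (simp add: qweyl_auts_def Bij_def bij_betw_def)
    thus ?thesis using that by (rule inj_onD) simp_all
  qed
  have comm: "\<exists>u. qweyl_class q (b * a - a * b) = qweyl_class q (free_z * u)" for a b
    using commutator_free_z_multiples[OF q_neq_0 q_neq_1, of b a]
    by (auto simp: free_z_multiples_def class_eq_iff)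
  obtain a b where a: "\<rho> (qweyl_class q (free_gen LX)) = qweyl_class q a"
    and b: "\<rho> (qweyl_class q (free_gen LY)) = qweyl_class q b"
    using aut_class_image[OF \<rho>] by metis
  obtain u where u: "qweyl_class q (b * a - a * b) = qweyl_class q (free_z * u)"
    using comm by blast
  have \<rho>z: "\<rho> (qweyl_class q free_z) = qweyl_class q (free_z * u)"
    unfolding free_z_def u[symmetric, unfolded free_z_def] by (intro aut_class_diff aut_class_mult \<rho> a b)
  obtain a' b' where a': "\<rho> (qweyl_class q a') = qweyl_class q (free_gen LX)"
    and b': "\<rho> (qweyl_class q b') = qweyl_class q (free_gen LY)"
    using aut_class_preimage[OF \<rho>] by metis
  obtain v where v: "qweyl_class q (b' * a' - a' * b') = qweyl_class q (free_z * v)"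
    using comm by blast
  have \<rho>zv: "\<rho> (qweyl_class q (free_z * v)) = qweyl_class q free_z"
    using aut_class_diff[OF \<rho> aut_class_mult[OF \<rho> b' a'] aut_class_mult[OF \<rho> a' b']]
    unfolding v by (simp only: free_z_def)
  \<comment> \<open>\<open>e\<close> represents the image of \<open>v\<close>, and \<open>u'\<close>
    the preimage of \<open>u\<close>. Cancelling z in z u e = z gives u e = 1; cancelling it in z v
    u' = z and then applying \<rho> gives e u = 1.\<close>
  obtain e where e: "\<rho> (qweyl_class q v) = qweyl_class q e" using aut_class_image[OF \<rho>] by blast
  obtain u' where u': "\<rho> (qweyl_class q u') = qweyl_class q u" using aut_class_preimage[OF \<rho>] by blast
  have "qweyl_class q (free_z * u * e) = qweyl_class q free_z"
    using aut_class_mult[OF \<rho> \<rho>z e] \<rho>zv by simp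
  hence ue: "free_act q (u * e) = free_act q 1"
    by - (rule free_act_z_cancel, simp add: class_eq_iff mult.assoc)
  have "\<rho> (qweyl_class q (free_z * v * u')) = qweyl_class q (free_z * u)"
    by (rule aut_class_mult[OF \<rho> \<rho>zv u'])
  hence "qweyl_class q (free_z * v * u') = qweyl_class q free_z"
    by (intro inj) (simp add: \<rho>z)
  hence "free_act q (v * u') = free_act q 1"
    by - (rule free_act_z_cancel, simp add: class_eq_iff mult.assoc)
  hence "\<rho> (qweyl_class q 1) = \<rho> (qweyl_class q (v * u'))" by (simp flip: class_eq_iff)
  hence eu: "free_act q (e * u) = free_act q 1"
    using aut_class_mult[OF \<rho> e u'] aut_class_one[OF \<rho>] by (simp flip: class_eq_iff)
  have "\<exists>l. free_act q u = free_act q (free_const l)"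
    by (rule free_act_unit_is_const[OF q_neq_0 q_generic ue eu])
  then obtain l where l: "free_act q u = free_act q (free_const l)" ..
  have "l \<noteq> 0"
    using fun_cong[OF ue, of 1] by (auto simp: free_act_mult l)
  moreover have "qweyl_class q (free_z * u) = qweyl_class q (free_const l * free_z)"
    unfolding class_eq_iff free_const_central by (rule free_act_mult_cong[OF refl l])
  ultimately show ?thesis using \<rho>z by auto
qed

text \<open>\<rho> carries the relations z x = q x z, y z = q z y and (q - 1) xy + 1 = z over to the
  images \<open>a\<close>, \<open>b\<close> and l z. The scalar l cancels from the first two, and
  \<open>free_act_generators_unique\<close> then identifies \<open>a\<close> and
  \<open>b\<close>.\<close>

lemma aut_is_torus:
  assumes \<rho>: "\<rho> \<in> qweyl_auts q"
  shows "\<exists>\<beta>. \<beta> \<noteq> 0 \<and> \<rho> = torus \<beta>"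
proof -
  obtain l where l: "l \<noteq> 0" and \<rho>z: "\<rho> (qweyl_class q free_z) = qweyl_class q (free_const l * free_z)"
    using aut_z[OF \<rho>] by blast
  obtain a b where a: "\<rho> (qweyl_class q (free_gen LX)) = qweyl_class q a"
    and b: "\<rho> (qweyl_class q (free_gen LY)) = qweyl_class q b"
    using aut_class_image[OF \<rho>] by metis
  note lift = aut_class_mult[OF \<rho>] aut_class_add[OF \<rho>] aut_class_scale[OF \<rho>] aut_class_one[OF \<rho>] a b \<rho>z
  have cancel: "free_act q c = free_act q d"
    if "qweyl_class q (free_const l * c) = qweyl_class q (free_const l * d)" for c d
    using that l by (simp add: class_eq_iff fun_eq_iff poly_eq_iff free_act_const_mult)
  have "free_act q (free_z * free_gen LX) = free_act q (free_const q * (free_gen LX * free_z))"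
    by (rule free_act_ext)
      (simp add: free_act_mult free_act_const_mult free_act_z_monom[OF q_neq_1] letter_act_LX_monom smult_monom
        del: letter_act.simps)
  hence "\<rho> (qweyl_class q (free_z * free_gen LX)) = \<rho> (qweyl_class q (free_const q * (free_gen LX * free_z)))"
    by (simp flip: class_eq_iff)
  hence "qweyl_class q (free_const l * free_z * a) = qweyl_class q (free_const q * (a * (free_const l * free_z)))"
    using lift(1)[OF \<rho>z a] lift(3)[OF lift(1)[OF a \<rho>z], of q] by simp
  hence az: "free_act q (free_z * a) = free_act q (free_const q * (a * free_z))"
    by (intro cancel) (simp add: mult.assoc free_const_left_commute[of a]
        free_const_left_commute[of "free_const q"])
  have "free_act q (free_gen LY * free_z) = free_act q (free_const q * (free_z * free_gen LY))"
  proof (rule free_act_ext)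
    fix n
    show "free_act q (free_gen LY * free_z) (monom 1 n) =
        free_act q (free_const q * (free_z * free_gen LY)) (monom 1 n)"
      by (cases n) (simp_all add: free_act_mult free_act_const_mult free_act_z_monom[OF q_neq_1]
          letter_act_LY_monom smult_monom del: letter_act.simps monom_eq_1)
  qed
  hence "\<rho> (qweyl_class q (free_gen LY * free_z)) = \<rho> (qweyl_class q (free_const q * (free_z * free_gen LY)))"
    by (simp flip: class_eq_iff)
  hence "qweyl_class q (b * (free_const l * free_z)) = qweyl_class q (free_const q * (free_const l * free_z * b))"
    using lift(1)[OF b \<rho>z] lift(3)[OF lift(1)[OF \<rho>z b], of q] by simp
  hence bz: "free_act q (b * free_z) = free_act q (free_const q * (free_z * b))"
    by (intro cancel) (simp add: mult.assoc free_const_left_commute[of b]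
        free_const_left_commute[of "free_const q"])
  have "free_act q (free_const (q - 1) * (free_gen LX * free_gen LY) + 1) = free_act q free_z"
  proof (rule free_act_ext)
    fix n
    have "(q - 1) * qint q n + 1 = q ^ n" using q_neq_1 by (simp add: qint_def)
    thus "free_act q (free_const (q - 1) * (free_gen LX * free_gen LY) + 1) (monom 1 n) =
        free_act q free_z (monom 1 n)"
      by (cases n) (simp_all add: free_act_mult free_act_add free_act_const_mult free_act_z_monom[OF q_neq_1]
          letter_act_LX_monom letter_act_LY_monom smult_monom add_monom del: letter_act.simps monom_eq_1)
  qed
  hence "\<rho> (qweyl_class q (free_const (q - 1) * (free_gen LX * free_gen LY) + 1)) = \<rho> (qweyl_class q free_z)"
    by (simp flip: class_eq_iff)
  hence "qweyl_class q (free_const (q - 1) * (a * b) + 1) = qweyl_class q (free_const l * free_z)"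
    using lift(2)[OF lift(3)[OF lift(1)[OF a b]] lift(4), of "q - 1"] \<rho>z by simp
  hence ab: "free_act q (free_const (q - 1) * (a * b) + 1) = free_act q (free_const l * free_z)"
    by (simp only: class_eq_iff)
  have "\<exists>\<beta>. \<beta> \<noteq> 0 \<and> free_act q a = free_act q (free_const (inverse \<beta>) * free_gen LX) \<and>
      free_act q b = free_act q (free_const \<beta> * free_gen LY)"
    by (rule free_act_generators_unique[OF q_neq_0 q_generic az bz ab])
  then obtain \<beta> where \<beta>: "\<beta> \<noteq> 0" "free_act q a = free_act q (free_const (inverse \<beta>) * free_gen LX)"
    "free_act q b = free_act q (free_const \<beta> * free_gen LY)" by blast
  have "\<rho> = torus \<beta>"
  proof (rule aut_eqI[OF \<rho> torus_aut[OF \<beta>(1)]])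
    show "\<rho> (qweyl_x q) = torus \<beta> (qweyl_x q)"
      using \<beta> by (simp add: torus_x class_eq_iff a[folded qweyl_x_def])
    show "\<rho> (qweyl_y q) = torus \<beta> (qweyl_y q)"
      using \<beta> by (simp add: torus_y class_eq_iff b[folded qweyl_y_def])
  qed
  with \<beta>(1) show ?thesis by blast
qed

end

section \<open>Roots of unity and isotropy groups\<close>

text \<open>The exponents s with \<beta>^s = 1 form a subgroup of the integers; by Bezout it
  contains S iff it contains the gcd.\<close>

lemma power_int_Gcd_eq_1_iff:
  fixes \<beta> :: "'k::field"
  assumes "finite S" "\<beta> \<noteq> 0"
  shows "(\<forall>s\<in>S. \<beta> powi s = 1) \<longleftrightarrow> \<beta> powi Gcd S = 1"
proof
  show "\<beta> powi Gcd S = 1" if "\<forall>s\<in>S. \<beta> powi s = 1"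
    using assms(1) that
  proof (induction S rule: finite_induct)
    case (insert s S)
    obtain u v where uv: "u * s + v * Gcd S = gcd s (Gcd S)" using bezout_int by blast
    have "\<beta> powi (u * s + v * Gcd S) = (\<beta> powi s) powi u * (\<beta> powi Gcd S) powi v"
      using assms(2) by (simp add: power_int_add mult.commute flip: power_int_mult)
    thus ?case using insert by (simp add: uv)
  qed simp
next
  assume *: "\<beta> powi Gcd S = 1"
  show "\<forall>s\<in>S. \<beta> powi s = 1"
  proof
    fix s assume "s \<in> S"
    then obtain k where k: "s = Gcd S * k" using Gcd_dvd dvdE by blast
    have "\<beta> powi (Gcd S * k) = 1" by (simp add: power_int_mult *)
    thus "\<beta> powi s = 1" by (simp only: k[symmetric])
  qed
qed

text \<open>
  Induction over the prime factors \<open>p\<close> of \<open>n = p m\<close>: if \<open>p\<close> divides \<open>m\<close>, a \<open>p\<close>-th root of a primitive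
  \<open>m\<close>-th root of unity is primitive of order \<open>n\<close>; otherwise multiply by a primitive \<open>p\<close>-th root of unity.
\<close>

lemma primitive_root_of_unity_exists:
  assumes "n > 0"
  shows "\<exists>z :: 'k::{alg_closed_field, field_char_0}. \<forall>k. z ^ k = 1 \<longleftrightarrow> n dvd k"
  using assms
proof (induction n rule: less_induct)
  case (less n)
  show ?case
  proof (cases "n = 1")
    case True
    thus ?thesis by (intro exI[of _ 1]) simp
  next
    case False
    then obtain p where p: "Factorial_Ring.prime p" "p dvd n" using prime_factor_nat by blast
    then obtain m where m: "n = p * m" by blast
    have "m > 0" "m < n" using less.prems m prime_gt_1_nat[OF p(1)] by auto
    with less.IH obtain z :: 'k where z: "\<And>k. z ^ k = 1 \<longleftrightarrow> m dvd k" by blast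
    have p0: "p > 0" using p prime_gt_0_nat by blast
    show ?thesis
    proof (cases "p dvd m")
      case True
      obtain x where x: "x ^ p = z" using nth_root_exists[OF p0] by blast
      have "x ^ k = 1 \<longleftrightarrow> n dvd k" for k
      proof
        assume k: "x ^ k = 1"
        have "z ^ k = (x ^ k) ^ p" unfolding x[symmetric] by (simp add: mult.commute flip: power_mult)
        hence "m dvd k" using k z by simp
        then obtain j where j: "k = m * j" by blast
        obtain i where i: "m = p * i" using True by blast
        have "z ^ (i * j) = x ^ k" unfolding x[symmetric] by (simp add: j i mult.assoc flip: power_mult)
        hence "m dvd i * j" using k z by simp
        hence "p * i dvd i * j" by (simp only: i)
        hence "p dvd j" using \<open>m > 0\<close> i by (simp add: mult.commute)
        thus "n dvd k" by (simp add: m j mult.commute)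
      next
        assume "n dvd k"
        then obtain j where "k = p * m * j" using m by blast
        thus "x ^ k = 1" using z[of "m * j"] by (simp add: power_mult x)
      qed
      thus ?thesis by blast
    next
      case False
      have "\<exists>e :: 'k. e ^ p = 1 \<and> e \<noteq> 1"
      proof -
        \<comment> \<open>A root of 1 + t + ... + t^(p-1) is a p-th root of unity, and it is not 1
          because the sum at 1 is p, nonzero in characteristic zero.\<close>
        obtain e :: 'k where e: "(\<Sum>k\<le>p - 1. 1 * e ^ k) = 0"
          using alg_closed[of "p - 1" "\<lambda>_. 1 :: 'k"] prime_gt_1_nat[OF p(1)] by auto
        have "(\<Sum>k<p. e ^ k) = 0" using e p0 by (simp add: lessThan_Suc_atMost[symmetric])
        moreover from this have "e \<noteq> 1" using p0 by auto
        ultimately show ?thesis using power_diff_1_eq[of e p] by auto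
      qed
      then obtain e :: 'k where e: "e ^ p = 1" "e \<noteq> 1" by blast
      have e': "e ^ k = 1 \<longleftrightarrow> p dvd k" for k
      proof
        assume k: "e ^ k = 1"
        show "p dvd k"
        proof (rule ccontr)
          assume "\<not> p dvd k"
          hence "coprime p k" using p(1) prime_imp_coprime by blast
          then obtain x y where xy: "k * x = p * y + 1"
            using bezout_nat[of k p] \<open>\<not> p dvd k\<close> by (metis coprime_commute coprime_iff_gcd_eq_1 dvd_0_right gr0I)
          have "e ^ (k * x) = 1" using k by (simp add: power_mult)
          hence "e ^ (p * y + 1) = 1" by (simp only: xy)
          thus False using e by (simp add: power_add power_mult)
        qed
      qed (auto simp: e power_mult elim!: dvdE)
      have "(z * e) ^ k = 1 \<longleftrightarrow> n dvd k" for k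
      proof
        assume k: "(z * e) ^ k = 1"
        have cop: "coprime p m" using p(1) False prime_imp_coprime by blast
        \<comment> \<open>Raising to the power p removes \<open>e\<close>, raising to the power m
          removes \<open>z\<close>, so the two orders can be read off separately.\<close>
        have "(z * e) ^ (k * p) = 1" "(z * e) ^ (k * m) = 1" using k by (simp_all add: power_mult)
        moreover have "e ^ (k * p) = 1" "z ^ (k * m) = 1" using e' z by simp_all
        ultimately have "z ^ (k * p) = 1" "e ^ (k * m) = 1" by (simp_all add: power_mult_distrib)
        hence "m dvd k * p" "p dvd k * m" using z e' by simp_all
        hence "m dvd k" "p dvd k" using cop by (simp_all add: coprime_dvd_mult_left_iff coprime_commute)
        thus "n dvd k" unfolding m using cop by (intro divides_mult)
      next
        assume "n dvd k"
        hence "m dvd k" "p dvd k" unfolding m by (blast intro: dvd_trans dvd_triv_left dvd_triv_right)+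
        hence "z ^ k = 1" "e ^ k = 1" using z e' by simp_all
        thus "(z * e) ^ k = 1" by (simp add: power_mult_distrib)
      qed
      thus ?thesis by blast
    qed
  qed
qed

text \<open>The n powers are distinct, and t^n - 1 has at most n roots.\<close>

lemma roots_of_unity_eq_powers:
  fixes z :: "'k::field"
  assumes z: "\<And>k. z ^ k = 1 \<longleftrightarrow> n dvd k" and n: "n > 0"
  shows "inj_on (\<lambda>k. z ^ k) {..<n}" "(\<lambda>k. z ^ k) ` {..<n} = {x. x ^ n = 1}"
proof -
  have z0: "z \<noteq> 0" using z[of n] n by (auto simp: power_0_left)
  have *: "i = j" if "i \<le> j" "j < n" "z ^ i = z ^ j" for i j
  proof -
    have "z ^ i * z ^ (j - i) = z ^ j" using that(1) by (simp flip: power_add)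
    hence "z ^ i * z ^ (j - i) = z ^ i * 1" by (simp only: that(3) mult_1_right)
    hence "n dvd j - i" using z0 z by simp
    thus ?thesis using that by (auto dest: dvd_imp_le)
  qed
  show inj: "inj_on (\<lambda>k. z ^ k) {..<n}"
  proof (rule inj_onI)
    fix i j assume "i \<in> {..<n}" "j \<in> {..<n}" "z ^ i = z ^ j"
    thus "i = j" using *[of i j] *[of j i] by (cases "i \<le> j") auto
  qed
  let ?p = "monom 1 n - 1 :: 'k poly"
  have "coeff ?p n = 1" using n by simp
  hence p: "?p \<noteq> 0" by (metis coeff_0 zero_neq_one)
  have roots: "{x. poly ?p x = 0} = {x :: 'k. x ^ n = 1}" by (simp add: poly_monom)
  have deg: "degree ?p \<le> n" by (intro degree_diff_le) (simp_all add: degree_monom_le)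
  show "(\<lambda>k. z ^ k) ` {..<n} = {x. x ^ n = 1}"
  proof (rule card_seteq)
    show "finite {x :: 'k. x ^ n = 1}" using poly_roots_finite[OF p] by (simp only: roots)
    show "(\<lambda>k. z ^ k) ` {..<n} \<subseteq> {x. x ^ n = 1}"
      using z by (auto simp flip: power_mult)
    have "card {x :: 'k. x ^ n = 1} \<le> degree ?p" using card_poly_roots_bound[OF p] by (simp only: roots)
    thus "card {x :: 'k. x ^ n = 1} \<le> card ((\<lambda>k. z ^ k) ` {..<n})"
      using deg by (simp add: card_image[OF inj])
  qed
qed

section \<open>Isotropy groups of inner skew derivations\<close>

context generic_qweyl
begin

text \<open>Diagonal operators commute with every rescaling of t.\<close>

lemma torus_z: "\<beta> \<noteq> 0 \<Longrightarrow> torus \<beta> (qweyl_class q free_z) = qweyl_class q free_z"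
proof (rule torus_class)
  show "torus_related q \<beta> free_z free_z"
    unfolding torus_related_def
    by (intro allI poly_eqI) (simp add: coeff_free_act_z[OF q_neq_1] coeff_pcompose_linear)
qed

lemma torus_pbw_sum:
  "\<beta> \<noteq> 0 \<Longrightarrow> torus \<beta> (qweyl_class q (pbw_sum c)) =
    qweyl_class q (pbw_sum (\<lambda>p. c p * \<beta> powi (int (snd p) - int (fst p))))"
  by (rule torus_class[OF _ torus_related_pbw_sum])

lemma inner_skew_derivation_class:
  assumes "\<rho> \<in> qweyl_auts q" "\<rho> (qweyl_class q a) = qweyl_class q a'"
  shows "inner_skew_derivation q \<rho> (qweyl_class q w) (qweyl_class q a) = qweyl_class q (w * a - a' * w)"
  using assms by (simp add: inner_skew_derivation_def qweyl_class_diff qweyl_class_mult)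

text \<open>z has distinct eigenvalues on the powers of t, so an operator commuting with it is
  diagonal. Only monomials with equal exponents contribute to the diagonal, and these are absent;
  the operator is 0 and independence applies.\<close>

lemma pbw_sum_commutes_z:
  assumes fin: "finite {p. c p \<noteq> 0}" and diag: "\<And>i. c (i, i) = 0"
    and comm: "free_act q (pbw_sum c * free_z) = free_act q (free_z * pbw_sum c)"
  shows "c p = 0"
proof -
  have "free_act q (pbw_sum c) = free_act q 0"
  proof (rule free_act_ext, rule poly_eqI)
    fix n m
    show "coeff (free_act q (pbw_sum c) (monom 1 n)) m = coeff (free_act q 0 (monom 1 n)) m"
    proof (cases "m = n")
      case True
      have "coeff (free_act q (pbw_sum c) (monom 1 n)) n =
          (\<Sum>p\<in>{p. c p \<noteq> 0}. if n - snd p + fst p = n then c p * qfall q n (snd p) else 0)"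
        by (rule coeff_free_act_pbw_sum[OF fin]) simp
      also have "\<dots> = 0"
      proof (rule sum.neutral, rule ballI)
        fix p assume p: "p \<in> {p. c p \<noteq> 0}"
        have "n < snd p" if "n - snd p + fst p = n"
        proof (rule ccontr)
          assume "\<not> n < snd p"
          with that have "fst p = snd p" by linarith
          hence "c p = 0" using diag[of "snd p"] by (metis prod.collapse)
          with p show False by simp
        qed
        thus "(if n - snd p + fst p = n then c p * qfall q n (snd p) else 0) = 0"
          by (simp add: qfall_eq_0)
      qed
      finally show ?thesis using True by simp
    next
      case False
      have "free_act q free_z (monom 1 n) = smult (q ^ n) (monom 1 n)"
        by (simp add: free_act_z_monom[OF q_neq_1] smult_monom)
      hence "q ^ n * coeff (free_act q (pbw_sum c) (monom 1 n)) m =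
          q ^ m * coeff (free_act q (pbw_sum c) (monom 1 n)) m"
        using arg_cong[OF fun_cong[OF comm, of "monom 1 n"], of "\<lambda>p. coeff p m"]
        by (simp add: free_act_mult free_act_smult coeff_free_act_z[OF q_neq_1])
      moreover have "q ^ n \<noteq> q ^ m"
        using power_eq_iff_of_generic[OF q_neq_0, of n m] q_generic False by blast
      ultimately show ?thesis by simp
    qed
  qed
  thus ?thesis using pbw_sum_independent[of q c p] fin q_generic by blast
qed

text \<open>
  At \<open>z\<close>, which all automorphisms fix, commutation with \<open>ad\<^sub>w\<close> says that \<open>\<rho> w - w\<close> commutes with \<open>z\<close>,
  so it has no component of nonzero degree; its component of degree \<open>0\<close> vanishes anyway.
\<close>

lemma torus_commutes_iff:
  assumes \<beta>: "\<beta> \<noteq> 0" and \<sigma>: "\<sigma> \<in> qweyl_auts q" and fin: "finite {p. c p \<noteq> 0}"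
    and w: "w = qweyl_class q (pbw_sum c)" and \<delta>: "\<delta> = inner_skew_derivation q \<sigma> w"
  shows "(\<forall>a\<in>C. torus \<beta> (\<delta> a) = \<delta> (torus \<beta> a)) \<longleftrightarrow>
    (\<forall>i j. c (i, j) \<noteq> 0 \<longrightarrow> \<beta> powi (int j - int i) = 1)"
proof -
  let ?d = "\<lambda>p. c p * \<beta> powi (int (snd p) - int (fst p))"
  have aut: "torus \<beta> \<in> qweyl_auts q" by (rule torus_aut[OF \<beta>])
  obtain \<mu> where \<mu>: "\<mu> \<noteq> 0" "\<sigma> = torus \<mu>" using aut_is_torus[OF \<sigma>] by blast
  have tw: "torus \<beta> w = qweyl_class q (pbw_sum ?d)"
    unfolding w by (rule torus_pbw_sum[OF \<beta>])
  have tw': "torus \<beta> (qweyl_class q (pbw_sum c)) = qweyl_class q (pbw_sum ?d)"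
    using tw by (simp only: w)
  \<comment> \<open>\<sigma> is itself in the torus and so commutes with \<rho> =
    \<open>torus \<beta>\<close>. Hence \<rho> (\<delta> a) is the skew commutator of \<rho> w with
    \<rho> a, while \<delta> (\<rho> a) is that of w with \<rho> a.\<close>
  have key: "torus \<beta> (\<delta> (qweyl_class q a)) = qweyl_class q (pbw_sum ?d * a' - s' * pbw_sum ?d) \<and>
      \<delta> (torus \<beta> (qweyl_class q a)) = qweyl_class q (pbw_sum c * a' - s' * pbw_sum c)"
    if a: "torus \<beta> (qweyl_class q a) = qweyl_class q a'" and s: "\<sigma> (qweyl_class q a') = qweyl_class q s'"
    for a a' s'
  proof -
    obtain s where s0: "\<sigma> (qweyl_class q a) = qweyl_class q s" using aut_class_image[OF \<sigma>] .
    have "torus \<beta> (\<sigma> (qweyl_class q a)) = \<sigma> (torus \<beta> (qweyl_class q a))"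
      using \<beta> \<mu> by (simp add: torus_comp mult.commute)
    hence s1: "torus \<beta> (qweyl_class q s) = qweyl_class q s'" by (simp only: s0 a s)
    have "torus \<beta> (\<delta> (qweyl_class q a)) = qweyl_class q (pbw_sum ?d * a' - s' * pbw_sum ?d)"
      unfolding \<delta> w inner_skew_derivation_class[OF \<sigma> s0]
      by (rule aut_class_diff[OF aut aut_class_mult[OF aut tw' a] aut_class_mult[OF aut s1 tw']])
    moreover have "\<delta> (torus \<beta> (qweyl_class q a)) = qweyl_class q (pbw_sum c * a' - s' * pbw_sum c)"
      unfolding \<delta> w a by (rule inner_skew_derivation_class[OF \<sigma> s])
    ultimately show ?thesis ..
  qed
  show ?thesis
  proof
    assume *: "\<forall>a\<in>C. torus \<beta> (\<delta> a) = \<delta> (torus \<beta> a)"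
    \<comment> \<open>Because \<sigma> fixes z, the skew commutator with z is an ordinary
      commutator.\<close>
    have \<sigma>z: "\<sigma> (qweyl_class q free_z) = qweyl_class q free_z"
      unfolding \<mu>(2) by (rule torus_z[OF \<mu>(1)])
    let ?e = "\<lambda>p. ?d p - c p"
    have fin_d: "finite {p. ?d p \<noteq> 0}" by (rule finite_subset[OF _ fin]) auto
    have "qweyl_class q (pbw_sum ?d * free_z - free_z * pbw_sum ?d) =
        qweyl_class q (pbw_sum c * free_z - free_z * pbw_sum c)"
      using key[OF torus_z[OF \<beta>] \<sigma>z] bspec[OF * qweyl_class_closed[of q free_z]] by argo
    hence "free_act q (pbw_sum ?e * free_z) = free_act q (free_z * pbw_sum ?e)"
      unfolding pbw_sum_diff[OF fin_d fin]
      unfolding class_eq_iff fun_eq_iff by (simp add: free_act_minus left_diff_distrib right_diff_distrib algebra_simps)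
    moreover have "finite {p. ?e p \<noteq> 0}" by (rule finite_subset[OF _ fin]) auto
    ultimately have "?e p = 0" for p
      using pbw_sum_commutes_z[of ?e p] by simp
    hence "c p * \<beta> powi (int (snd p) - int (fst p)) = c p" for p by simp
    thus "\<forall>i j. c (i, j) \<noteq> 0 \<longrightarrow> \<beta> powi (int j - int i) = 1"
      by (metis fst_conv snd_conv mult_cancel_left2)
  next
    assume *: "\<forall>i j. c (i, j) \<noteq> 0 \<longrightarrow> \<beta> powi (int j - int i) = 1"
    have d: "?d = c"
    proof
      fix p
      show "?d p = c p" using * by (cases p; cases "c p = 0") auto
    qed
    show "\<forall>a\<in>C. torus \<beta> (\<delta> a) = \<delta> (torus \<beta> a)"
    proof
      fix r assume "r \<in> C"
      then obtain a where a: "r = qweyl_class q a" by (rule qweyl_class_surj)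
      obtain a' where a': "torus \<beta> (qweyl_class q a) = qweyl_class q a'"
        using aut_class_image[OF aut] .
      obtain s' where "\<sigma> (qweyl_class q a') = qweyl_class q s'" using aut_class_image[OF \<sigma>] .
      from key[OF a' this] show "torus \<beta> (\<delta> r) = \<delta> (torus \<beta> r)"
        unfolding a d by simp
    qed
  qed
qed

lemma carrier_isotropy_group:
  assumes "\<sigma> \<in> qweyl_auts q" "finite {p. c p \<noteq> 0}" "w = qweyl_class q (pbw_sum c)"
    and S: "S = {int j - int i | i j. c (i, j) \<noteq> 0}"
  shows "carrier (isotropy_group q (inner_skew_derivation q \<sigma> w)) = torus ` {\<beta>. \<beta> \<noteq> 0 \<and> \<beta> powi Gcd S = 1}"
proof -
  have "S \<subseteq> (\<lambda>p. int (snd p) - int (fst p)) ` {p. c p \<noteq> 0}"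
  proof
    fix s assume "s \<in> S"
    then obtain i j where "s = int j - int i" "c (i, j) \<noteq> 0" unfolding S by blast
    thus "s \<in> (\<lambda>p. int (snd p) - int (fst p)) ` {p. c p \<noteq> 0}"
      by (intro image_eqI[of _ _ "(i, j)"]) simp_all
  qed
  hence fin: "finite S" using assms(2) by (rule finite_subset[OF _ finite_imageI])
  have iff: "(\<forall>i j. c (i, j) \<noteq> 0 \<longrightarrow> \<beta> powi (int j - int i) = 1) \<longleftrightarrow> \<beta> powi Gcd S = 1" if "\<beta> \<noteq> 0" for \<beta> :: 'k
    unfolding power_int_Gcd_eq_1_iff[OF fin that, symmetric] unfolding S by blast
  have "carrier (isotropy_group q (inner_skew_derivation q \<sigma> w)) =
      {\<rho> \<in> qweyl_auts q. \<forall>a\<in>C. \<rho> (inner_skew_derivation q \<sigma> w a) = inner_skew_derivation q \<sigma> w (\<rho> a)}"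
    by (simp add: isotropy_group_def qweyl_Aut_def)
  also have "\<dots> = torus ` {\<beta>. \<beta> \<noteq> 0 \<and> \<beta> powi Gcd S = 1}"
  proof (intro equalityI subsetI)
    fix \<rho>
    assume "\<rho> \<in> {\<rho> \<in> qweyl_auts q. \<forall>a\<in>C. \<rho> (inner_skew_derivation q \<sigma> w a) = inner_skew_derivation q \<sigma> w (\<rho> a)}"
    moreover from this obtain \<beta> where \<beta>: "\<beta> \<noteq> 0" "\<rho> = torus \<beta>" using aut_is_torus by blast
    ultimately have "\<beta> powi Gcd S = 1"
      using torus_commutes_iff[OF \<beta>(1) assms(1-3) refl] iff[OF \<beta>(1)] by blast
    with \<beta> show "\<rho> \<in> torus ` {\<beta>. \<beta> \<noteq> 0 \<and> \<beta> powi Gcd S = 1}" by blast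
  next
    fix \<rho> assume "\<rho> \<in> torus ` {\<beta>. \<beta> \<noteq> 0 \<and> \<beta> powi Gcd S = 1}"
    then obtain \<beta> where \<beta>: "\<beta> \<noteq> 0" "\<rho> = torus \<beta>" and "\<beta> powi Gcd S = 1" by blast
    thus "\<rho> \<in> {\<rho> \<in> qweyl_auts q. \<forall>a\<in>C. \<rho> (inner_skew_derivation q \<sigma> w a) = inner_skew_derivation q \<sigma> w (\<rho> a)}"
      using torus_commutes_iff[OF \<beta>(1) assms(1-3) refl] iff[OF \<beta>(1)] torus_aut by blast
  qed
  finally show ?thesis .
qed

lemma torus_mult:
  assumes "\<beta> \<noteq> 0" "\<gamma> \<noteq> 0"
  shows "torus \<beta> \<otimes>\<^bsub>isotropy_group q \<delta>\<^esub> torus \<gamma> = torus (\<beta> * \<gamma>)"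
proof -
  have "torus \<beta> \<otimes>\<^bsub>isotropy_group q \<delta>\<^esub> torus \<gamma> = compose C (torus \<beta>) (torus \<gamma>)"
    using assms by (simp add: isotropy_group_def qweyl_Aut_def BijGroup_def torus_Bij)
  also have "\<dots> = torus (\<beta> * \<gamma>)"
  proof
    fix r
    show "compose C (torus \<beta>) (torus \<gamma>) r = torus (\<beta> * \<gamma>) r"
      by (cases "r \<in> C") (simp_all add: compose_def torus_comp assms mult.commute torus_def[of "_ * _"])
  qed
  finally show ?thesis .
qed

lemma inj_on_torus: "inj_on torus {\<beta>. \<beta> \<noteq> 0 \<and> P \<beta>}"
  by (rule inj_onI) (auto intro: torus_inj)

lemma isotropy_group_iso_units:
  assumes "carrier (isotropy_group q \<delta>) = torus ` {\<beta>. \<beta> \<noteq> 0}"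
  shows "isotropy_group q \<delta> \<cong> units_of (ring_of_type_algebra :: 'k ring)"
proof -
  interpret K: field "ring_of_type_algebra :: 'k ring" by (rule field_from_type_algebra)
  have units: "carrier (units_of (ring_of_type_algebra :: 'k ring)) = {\<beta>. \<beta> \<noteq> 0}"
    using K.field_Units by (auto simp: units_of_carrier ring_of_type_algebra_def)
  have mult: "x \<otimes>\<^bsub>units_of (ring_of_type_algebra :: 'k ring)\<^esub> y = x * y" for x y
    by (simp add: units_of_def ring_of_type_algebra_def)
  have "torus \<in> iso (units_of (ring_of_type_algebra :: 'k ring)) (isotropy_group q \<delta>)"
    using inj_on_torus[of "\<lambda>_. True"]
    by (intro isoI homI) (auto simp: units mult assms torus_mult bij_betw_def)
  from group.iso_sym[OF K.units_group is_isoI[OF this]] show ?thesis .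
qed

text \<open>The powers of the primitive root \<open>z\<close> below d are exactly the admissible
  \<beta>, and z^m depends only on m modulo d. \<open>nat\<close> appears because the residues of
  \<open>integer_mod_group\<close> are integers.\<close>

lemma isotropy_group_iso_cyclic:
  fixes z :: 'k
  assumes carrier: "carrier (isotropy_group q \<delta>) = torus ` {\<beta>. \<beta> \<noteq> 0 \<and> \<beta> powi int d = 1}"
    and d: "d > 0" and z: "\<And>k. z ^ k = 1 \<longleftrightarrow> d dvd k"
  shows "isotropy_group q \<delta> \<cong> integer_mod_group d"
proof -
  have z0: "z \<noteq> 0" using z[of d] d by (auto simp: power_0_left)
  have roots: "{\<beta>. \<beta> \<noteq> 0 \<and> \<beta> powi int d = 1} = (\<lambda>k. z ^ k) ` {..<d}"
    using roots_of_unity_eq_powers(2)[OF z d] d by (auto simp: power_0_left)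
  let ?h = "\<lambda>i. torus (z ^ nat i)"
  have "?h \<in> iso (integer_mod_group d) (isotropy_group q \<delta>)"
  proof (intro isoI homI)
    fix i j assume ij: "i \<in> carrier (integer_mod_group d)" "j \<in> carrier (integer_mod_group d)"
    have "z ^ nat ((i + j) mod int d) = z ^ (nat i + nat j)"
    proof -
      have "nat ((i + j) mod int d) = (nat i + nat j) mod d"
        using ij d by (simp add: carrier_integer_mod_group nat_mod_distrib nat_add_distrib)
      moreover have "z ^ (m mod d) = z ^ m" for m
      proof -
        have "z ^ m = z ^ (d * (m div d) + m mod d)" by simp
        also have "\<dots> = z ^ (m mod d)" using z[of d] by (simp only: power_add power_mult) simp
        finally show ?thesis ..
      qed
      ultimately show ?thesis by simp
    qed
    thus "?h (i \<otimes>\<^bsub>integer_mod_group d\<^esub> j) = ?h i \<otimes>\<^bsub>isotropy_group q \<delta>\<^esub> ?h j"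
      using z0 by (simp add: torus_mult power_add)
  next
    fix i assume "i \<in> carrier (integer_mod_group d)"
    hence "nat i \<in> {..<d}" using d by (auto simp: carrier_integer_mod_group)
    thus "?h i \<in> carrier (isotropy_group q \<delta>)" unfolding carrier roots by blast
  next
    have "bij_betw nat {0..<int d} {..<d}"
      by (rule bij_betwI[of _ _ _ int]) auto
    moreover have "bij_betw (\<lambda>k. z ^ k) {..<d} {\<beta>. \<beta> \<noteq> 0 \<and> \<beta> powi int d = 1}"
      unfolding roots using roots_of_unity_eq_powers(1)[OF z d] by (rule inj_on_imp_bij_betw)
    moreover have "bij_betw torus {\<beta>. \<beta> \<noteq> 0 \<and> \<beta> powi int d = 1} (carrier (isotropy_group q \<delta>))"
      unfolding carrier by (rule inj_on_imp_bij_betw[OF inj_on_torus])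
    ultimately have "bij_betw (torus \<circ> ((\<lambda>k. z ^ k) \<circ> nat)) {0..<int d} (carrier (isotropy_group q \<delta>))"
      by (blast intro: bij_betw_trans)
    thus "bij_betw ?h (carrier (integer_mod_group d)) (carrier (isotropy_group q \<delta>))"
      using d by (simp add: carrier_integer_mod_group comp_def)
  qed
  from group.iso_sym[OF group_integer_mod_group is_isoI[OF this]] show ?thesis .
qed

text \<open>Brings the diagonal sum into the form \<open>pbw_sum\<close>, so that
  \<open>pbw_sum_inj\<close> turns its equality with w into equality of coefficients.\<close>

lemma diagonal_sum_class:
  assumes "finite {p. c p \<noteq> 0}"
  shows "(\<Oplus>\<^bsub>qweyl q\<^esub>i\<in>{i. c (i, i) \<noteq> 0}. qweyl_scale q (c (i, i)) (qweyl_monom q i i)) =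
    qweyl_class q (pbw_sum (\<lambda>p. if fst p = snd p then c p else 0))"
proof -
  let ?I = "{i. c (i, i) \<noteq> 0}"
  have inj: "inj_on (\<lambda>i. (i, i)) ?I" by (rule inj_onI) simp
  have "(\<lambda>i. (i, i)) ` ?I \<subseteq> {p. c p \<noteq> 0}" by auto
  hence fin: "finite ?I" using assms finite_imageD[OF _ inj] finite_subset by blast
  have "{p. (if fst p = snd p then c p else 0) \<noteq> 0} = (\<lambda>i. (i, i)) ` ?I" by auto
  hence "pbw_sum (\<lambda>p. if fst p = snd p then c p else 0) = (\<Sum>i\<in>?I. free_const (c (i, i)) * pbw_monom i i)"
    by (simp add: pbw_sum_def sum.reindex[OF inj])
  thus ?thesis
    using fin by (simp add: qweyl_class_sum qweyl_class_const_mult qweyl_monom_eq_class)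
qed

end

theorem corollary9:
  fixes q \<mu> :: "'k::{alg_closed_field, field_char_0}"
    and \<sigma> :: "'k free_alg set \<Rightarrow> 'k free_alg set"
    and c :: "nat \<times> nat \<Rightarrow> 'k"
    and w :: "'k free_alg set"
    and S :: "int set"
    and \<delta> :: "'k free_alg set \<Rightarrow> 'k free_alg set"
  assumes q_nonzero: "q \<noteq> 0"
    and q_not_root_of_unity: "\<forall>n::nat. n > 0 \<longrightarrow> q ^ n \<noteq> 1"
    and \<mu>_nonzero: "\<mu> \<noteq> 0"
    and \<sigma>_aut: "\<sigma> \<in> carrier (qweyl_Aut q)"
    and \<sigma>_x: "\<sigma> (qweyl_x q) = qweyl_scale q (inverse \<mu>) (qweyl_x q)"
    and \<sigma>_y: "\<sigma> (qweyl_y q) = qweyl_scale q \<mu> (qweyl_y q)"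
    and c_finite: "finite {p. c p \<noteq> 0}"
    and w_eq: "w = (\<Oplus>\<^bsub>qweyl q\<^esub>p\<in>{p. c p \<noteq> 0}.
                      qweyl_scale q (c p) (qweyl_monom q (fst p) (snd p)))"
    and S_eq: "S = {int j - int i | i j. c (i, j) \<noteq> 0}"
    and \<delta>_eq: "\<delta> = inner_skew_derivation q \<sigma> w"
  shows "(w = (\<Oplus>\<^bsub>qweyl q\<^esub>i\<in>{i. c (i, i) \<noteq> 0}.
                 qweyl_scale q (c (i, i)) (qweyl_monom q i i)) \<longleftrightarrow> Gcd S = 0)
       \<and> (w = (\<Oplus>\<^bsub>qweyl q\<^esub>i\<in>{i. c (i, i) \<noteq> 0}.
                 qweyl_scale q (c (i, i)) (qweyl_monom q i i)) \<longrightarrow>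
             isotropy_group q \<delta> \<cong> units_of (ring_of_type_algebra :: 'k ring))
       \<and> (\<forall>d::nat. int d = Gcd S \<and> d \<notin> {0, 1} \<longrightarrow>
             isotropy_group q \<delta> \<cong> integer_mod_group d)
       \<and> (Gcd S = 1 \<longrightarrow> isotropy_group q \<delta> \<cong> singleton_group (\<lambda>a\<in>carrier (qweyl q). a))"
proof -
  interpret generic_qweyl q
    using q_nonzero q_not_root_of_unity by unfold_locales auto
  have w: "w = qweyl_class q (pbw_sum c)"
    unfolding w_eq by (rule pbw_sum_class[OF c_finite, symmetric])
  have \<sigma>: "\<sigma> \<in> qweyl_auts q" using \<sigma>_aut by (simp add: qweyl_Aut_def)
  have carrier: "carrier (isotropy_group q \<delta>) = torus ` {\<beta>. \<beta> \<noteq> 0 \<and> \<beta> powi Gcd S = 1}"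
    unfolding \<delta>_eq by (rule carrier_isotropy_group[OF \<sigma> c_finite w S_eq])
  let ?c = "\<lambda>p. if fst p = snd p then c p else 0"
  have fin: "finite {p. ?c p \<noteq> 0}" by (rule finite_subset[OF _ c_finite]) auto
  have "w = qweyl_class q (pbw_sum ?c) \<longleftrightarrow> c = ?c"
  proof
    show "c = ?c" if "w = qweyl_class q (pbw_sum ?c)"
      using that unfolding w by (rule pbw_sum_inj[OF c_finite fin])
    assume "c = ?c"
    from arg_cong[OF this, of pbw_sum] show "w = qweyl_class q (pbw_sum ?c)" unfolding w by (rule arg_cong)
  qed
  also have "\<dots> \<longleftrightarrow> (\<forall>i j. c (i, j) \<noteq> 0 \<longrightarrow> i = j)"
    by (auto simp: fun_eq_iff)
  also have "\<dots> \<longleftrightarrow> S \<subseteq> {0}"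
  proof (intro iffI allI impI)
    show "S \<subseteq> {0}" if "\<forall>i j. c (i, j) \<noteq> 0 \<longrightarrow> i = j"
      using that unfolding S_eq by fastforce
    fix i j assume "S \<subseteq> {0}" "c (i, j) \<noteq> 0"
    moreover from this have "int j - int i \<in> S" unfolding S_eq by blast
    ultimately show "i = j" by auto
  qed
  finally have diag: "w = (\<Oplus>\<^bsub>qweyl q\<^esub>i\<in>{i. c (i, i) \<noteq> 0}.
      qweyl_scale q (c (i, i)) (qweyl_monom q i i)) \<longleftrightarrow> Gcd S = 0"
    unfolding diagonal_sum_class[OF c_finite] by (simp only: Gcd_0_iff)
  \<comment> \<open>With exponent 0 the condition \<open>\<beta> powi Gcd S = 1\<close> always
    holds, so the whole torus remains.\<close>
  have "isotropy_group q \<delta> \<cong> units_of (ring_of_type_algebra :: 'k ring)" if "Gcd S = 0"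
    by (rule isotropy_group_iso_units) (simp add: carrier that)
  moreover have "isotropy_group q \<delta> \<cong> integer_mod_group d" if "int d = Gcd S" "d \<notin> {0, 1}" for d
  proof -
    have "d > 0" using that(2) by simp
    obtain z :: 'k where "\<And>k. z ^ k = 1 \<longleftrightarrow> d dvd k"
      using primitive_root_of_unity_exists[OF \<open>d > 0\<close>] by blast
    thus ?thesis using \<open>d > 0\<close> by (intro isotropy_group_iso_cyclic) (simp_all only: carrier that(1))
  qed
  moreover have "isotropy_group q \<delta> \<cong> singleton_group (\<lambda>a\<in>carrier (qweyl q). a)" if "Gcd S = 1"
  proof -
    \<comment> \<open>With exponent 1 the condition leaves only \<beta> = 1, and
      \<open>torus 1\<close> is the identity on the carrier.\<close>
    have car: "carrier (isotropy_group q \<delta>) = {torus 1}" by (auto simp: carrier that)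
    have mult: "torus 1 \<otimes>\<^bsub>isotropy_group q \<delta>\<^esub> torus 1 = torus 1" by (simp add: torus_mult)
    have "id \<in> iso (isotropy_group q \<delta>) (singleton_group (torus 1))"
      by (intro isoI homI) (simp_all add: car mult singleton_group_def)
    hence "id \<in> iso (isotropy_group q \<delta>) (singleton_group (\<lambda>a\<in>carrier (qweyl q). a))"
      by (simp only: torus_1)
    thus ?thesis by (rule is_isoI)
  qed
  ultimately show ?thesis using diag by blast
qed

end
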